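(* Let $m$ be a positive integer and $b\in\mathbb{Z}$ with $(b,m)=1$. For $Q\ge1$ let $$\mathfrak{F}_Q^{(m,b)}=\Big\{\tfrac{a}{q}: 0<a\le q\le Q,\ (a,q)=1,\ q\equiv b \pmod m\Big\}.$$ Then the pair correlation function $\widetilde g_{(m)}$ of the sequence $(\mathfrak{F}_Q^{(m,b)})_Q$ (as $Q\to\infty$) exists, is independent of $b$, and is given by $\widetilde g_{(m)}(\lambda)=g_{(m)}(\varphi(m)\lambda)$ for all $\lambda>0$, where $$ g_{(m)}(\lambda)=\frac{\varphi(m)}{m}\cdot\frac{C_m}{\lambda^2}\sum_{1\le \Delta\le \frac{2\lambda}{C_m}}\varphi(\Delta)\,\frac{(\Delta,m)}{\varphi\big((\Delta,m)\big)}\,\log\frac{2\lambda}{C_m\Delta}, \qquad C_m=\frac{\varphi(m)}{m}\prod_{p\nmid m}\Big(1-\frac1{p^2}\Big). $$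
   Context: For a finite set $F\subseteq\mathbb{R}$ of cardinality $N(F)$ and an interval $I$, set $$\mathcal{G}_F(I)=\frac{1}{N(F)}\#\Big\{(x,y)\in F^2: y\neq x,\ y-x\in \tfrac{1}{N(F)}I+\mathbb{Z}\Big\}.$$ The pair correlation measure of an increasing family of finite sets $(F_n)$ is $\mathcal{G}(I)=\lim_n\mathcal{G}_{F_n}(I)$ (when it exists). If $G(\lambda):=\mathcal{G}([0,\lambda])=\int_0^\lambda g(x)\,dx$ for all $\lambda>0$, then $g$ is called the pair correlation function of $(F_n)$. $\varphi$ is Euler's totient function, the product is over primes, $(\Delta,m)$ is the gcd. *)

theory Defs
  imports "HOL-Analysis.Analysis" "HOL-Number_Theory.Number_Theory"
begin

definition pair_corr :: "real set \<Rightarrow> real set \<Rightarrow> real" where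
  "pair_corr F I =
     real (card {(x, y). x \<in> F \<and> y \<in> F \<and> y \<noteq> x \<and>
                  (\<exists>t\<in>I. \<exists>k::int. y - x = t / real (card F) + of_int k)}) / real (card F)"

text \<open>A pair correlation function is determined by its integrals only up to null sets, and
  only on the positive reals, so it is introduced as a relation.\<close>

definition has_pair_correlation_function :: "(nat \<Rightarrow> real set) \<Rightarrow> (real \<Rightarrow> real) \<Rightarrow> bool" where
  "has_pair_correlation_function F g \<longleftrightarrow>
     (\<forall>n. finite (F n)) \<and> incseq F \<and>
     (\<forall>l>0. set_integrable lborel {0..l} g \<and>
        (\<lambda>n. pair_corr (F n) {0..l}) \<longlonglongrightarrow> (LBINT x:{0..l}. g x))"

definition farey_cong :: "nat \<Rightarrow> int \<Rightarrow> nat \<Rightarrow> real set" where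
  "farey_cong m b Q =
     {real a / real q |a q. 0 < a \<and> a \<le> q \<and> q \<le> Q \<and> coprime a q \<and> [int q = b] (mod int m)}"

definition C_const :: "nat \<Rightarrow> real" where
  "C_const m = real (totient m) / real m *
     (\<Prod>p. if prime p \<and> \<not> p dvd m then 1 - 1 / (real p)\<^sup>2 else 1)"

definition g_fun :: "nat \<Rightarrow> real \<Rightarrow> real" where
  "g_fun m l = real (totient m) / real m * (C_const m / l\<^sup>2) *
     (\<Sum>d | 1 \<le> d \<and> real d \<le> 2 * l / C_const m.
        real (totient d) * (real (gcd d m) / real (totient (gcd d m))) *
        ln (2 * l / (C_const m * real d)))"

end

theory Submission imports Defs begin

text \<open>
  Write the difference of two reduced fractions as \<open>\<Delta> / (q q')\<close> with \<open>\<Delta> = a' q - a q'\<close>.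
  The number of fractions grows like a constant times \<open>Q\<^sup>2\<close>, so only boundedly many \<open>\<Delta>\<close>
  contribute, and for each of them the condition on the difference says that
  \<open>(q / Q, q' / Q)\<close> lies above a fixed hyperbola in the unit square.

  Given \<open>q\<close>, \<open>q'\<close> and \<open>\<Delta>\<close>, the number of \<open>a\<close> modulo \<open>q\<close> without any coprimality condition is
  \<open>gcd q q'\<close> or \<open>0\<close>, which reduces the count to coprime pairs \<open>(q, q')\<close> in residue classes;
  their density follows by sieving out one prime at a time. Sorting all solutions by
  \<open>(gcd a q, gcd a' q')\<close> expresses that count through the reduced solutions for the divisors of
  \<open>\<Delta>\<close>, so the density of the reduced solutions is determined by induction on \<open>\<Delta>\<close>.
  Finally, the area above the hyperbola \<open>x y = k\<close>, \<open>1 - k + k ln k\<close>, has derivative \<open>ln k\<close> in \<open>k\<close>, which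
  is the source of the logarithm in \<open>g\<close>.
\<close>

subsection \<open>Densities of counting functions of two variables\<close>

text \<open>Limits are taken in two independent variables because dividing \<open>(q, q')\<close> by
  \<open>(gcd a q, gcd a' q')\<close> shrinks the two sides of the box by different factors. The
  same division moves \<open>q\<close> and \<open>q'\<close> to other residue classes modulo
  \<open>m\<close>, so even for a single \<open>b\<close> the densities have to be proved for all
  pairs of unit classes at once. They do not depend on the classes, which is why \<open>b\<close>
  disappears from the result.

  Two more points shape the proof. Differences are taken modulo 1, so the second fraction may lie
  anywhere between 0 and 2 and is folded back. And the hyperbola depends on the actual number of
  fractions, known only asymptotically; its parameter moves with \<open>Q\<close>, which
  monotonicity and continuity of the area absorb.

  The constant \<open>\<nu> = euler_factor m / (2 * m)\<close> is the limit of the number of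
  fractions over \<open>Q\<^sup>2\<close>. Since \<open>C_const m = 2 * totient m * \<nu>\<close>,
  evaluating at \<open>totient m * l\<close> makes \<open>totient m\<close> cancel and leaves the
  cutoff \<open>\<Delta> \<le> l / \<nu>\<close>.\<close>

definition has_density :: "(real \<Rightarrow> real \<Rightarrow> real) \<Rightarrow> real \<Rightarrow> bool" where
  "has_density f L \<longleftrightarrow> ((\<lambda>(X, Y). f X Y / (X * Y)) \<longlongrightarrow> L) (at_top \<times>\<^sub>F at_top)"

lemma eventually_at_top_prod:
  "eventually (\<lambda>(X::real, Y::real). X \<ge> a \<and> Y \<ge> b) (at_top \<times>\<^sub>F at_top)"
  unfolding eventually_prod_filter
  by (rule exI[of _ "\<lambda>X. X \<ge> a"], rule exI[of _ "\<lambda>Y. Y \<ge> b"]) (auto intro: eventually_ge_at_top)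

lemma has_density_cong:
  assumes "has_density f L" and "\<And>X Y. X \<ge> a \<Longrightarrow> Y \<ge> b \<Longrightarrow> f X Y = g X Y"
  shows "has_density g L"
  unfolding has_density_def
  by (rule Lim_transform_eventually[OF assms(1)[unfolded has_density_def]],
      rule eventually_mono[OF eventually_at_top_prod[of a b]]) (auto simp: assms(2))

lemma has_density_zero: "has_density (\<lambda>X Y. 0) 0"
  by (simp add: has_density_def case_prod_unfold)

lemma has_density_diff:
  assumes "has_density f L" "has_density g M"
  shows "has_density (\<lambda>X Y. f X Y - g X Y) (L - M)"
  using tendsto_diff[OF assms[unfolded has_density_def]]
  by (simp add: has_density_def case_prod_unfold diff_divide_distrib)

lemma has_density_add:
  assumes "has_density f L" "has_density g M"
  shows "has_density (\<lambda>X Y. f X Y + g X Y) (L + M)"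
  using tendsto_add[OF assms[unfolded has_density_def]]
  by (simp add: has_density_def case_prod_unfold add_divide_distrib)

lemma has_density_cmult:
  assumes "has_density f L"
  shows "has_density (\<lambda>X Y. c * f X Y) (c * L)"
  using tendsto_mult_left[OF assms[unfolded has_density_def], of c]
  by (simp add: has_density_def case_prod_unfold)

lemma has_density_sum:
  assumes "\<And>i. i \<in> I \<Longrightarrow> has_density (f i) (L i)"
  shows "has_density (\<lambda>X Y. \<Sum>i\<in>I. f i X Y) (\<Sum>i\<in>I. L i)"
  using assms
  by (induction I rule: infinite_finite_induct) (auto intro: has_density_zero has_density_add)

lemma has_density_scale:
  assumes "has_density f L" "a > 0" "b > 0"
  shows "has_density (\<lambda>X Y. f (X / a) (Y / b)) (L / (a * b))"
proof -
  have "filterlim (\<lambda>x. (fst x / a, snd x / b)) (at_top \<times>\<^sub>F at_top) (at_top \<times>\<^sub>F at_top)"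
  proof (rule filterlim_Pair)
    show "filterlim (\<lambda>x. fst x / a) at_top (at_top \<times>\<^sub>F at_top)"
      using filterlim_tendsto_pos_mult_at_top[OF tendsto_const[of "1 / a"] _ filterlim_fst[of at_top at_top]]
        assms(2) by simp
    show "filterlim (\<lambda>x. snd x / b) at_top (at_top \<times>\<^sub>F at_top)"
      using filterlim_tendsto_pos_mult_at_top[OF tendsto_const[of "1 / b"] _ filterlim_snd[of at_top at_top]]
        assms(3) by simp
  qed
  from filterlim_compose[OF assms(1)[unfolded has_density_def] this]
  have "((\<lambda>(X, Y). f (X / a) (Y / b) / (X / a * (Y / b))) \<longlongrightarrow> L) (at_top \<times>\<^sub>F at_top)"
    by (simp add: case_prod_unfold)
  from tendsto_mult_left[OF this, of "1 / (a * b)"]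
  show ?thesis using assms(2,3) by (simp add: has_density_def case_prod_unfold field_simps)
qed

lemma has_density_bound:
  assumes "\<And>X Y. X \<ge> a \<Longrightarrow> Y \<ge> b \<Longrightarrow> \<bar>f X Y / (X * Y) - L\<bar> \<le> c / X + d / Y"
  shows "has_density f L"
proof -
  have "((\<lambda>x. c / fst x + d / snd x) \<longlongrightarrow> 0 + 0) (at_top \<times>\<^sub>F at_top)"
    by (intro tendsto_add tendsto_divide_0[OF tendsto_const]
          filterlim_at_top_imp_at_infinity filterlim_fst filterlim_snd)
  then have lim: "((\<lambda>(X, Y). c / X + d / Y) \<longlongrightarrow> 0) (at_top \<times>\<^sub>F at_top)"
    by (simp add: case_prod_unfold)
  have "((\<lambda>x. (case x of (X, Y) \<Rightarrow> f X Y / (X * Y)) - L) \<longlongrightarrow> 0) (at_top \<times>\<^sub>F at_top)"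
    by (rule Lim_null_comparison[OF _ lim], rule eventually_mono[OF eventually_at_top_prod[of a b]])
      (auto simp: assms)
  then show ?thesis unfolding has_density_def by (subst Lim_null) simp
qed

text \<open>The bounding functions may change with \<open>\<epsilon>\<close>: a sieve level is fixed
  first and only then do \<open>X\<close> and \<open>Y\<close> grow, so no uniformity in the level
  is asked for.\<close>

lemma has_density_sandwich:
  assumes "\<And>\<epsilon>. \<epsilon> > 0 \<Longrightarrow> \<exists>g h G H. has_density g G \<and> has_density h H \<and> L - \<epsilon> \<le> G \<and> H \<le> L + \<epsilon> \<and>
             (\<forall>X\<ge>1. \<forall>Y\<ge>1. g X Y \<le> f X Y \<and> f X Y \<le> h X Y)"
  shows "has_density f L"
  unfolding has_density_def
proof (rule tendstoI)
  fix e :: real assume "e > 0"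
  then obtain g h G H where gh: "has_density g G" "has_density h H" "L - e/2 \<le> G" "H \<le> L + e/2"
    and le: "\<And>X Y. X\<ge>1 \<Longrightarrow> Y\<ge>1 \<Longrightarrow> g X Y \<le> f X Y \<and> f X Y \<le> h X Y"
    using assms[of "e/2"] by auto
  have "eventually (\<lambda>(X,Y). g X Y / (X * Y) > G - e/2) (at_top \<times>\<^sub>F at_top)"
    using order_tendstoD(1)[OF gh(1)[unfolded has_density_def], of "G - e/2"] \<open>e > 0\<close>
    by (simp add: case_prod_unfold)
  moreover have "eventually (\<lambda>(X,Y). h X Y / (X * Y) < H + e/2) (at_top \<times>\<^sub>F at_top)"
    using order_tendstoD(2)[OF gh(2)[unfolded has_density_def], of "H + e/2"] \<open>e > 0\<close>
    by (simp add: case_prod_unfold)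
  ultimately show "eventually (\<lambda>x. dist (case x of (X, Y) \<Rightarrow> f X Y / (X * Y)) L < e) (at_top \<times>\<^sub>F at_top)"
    using eventually_at_top_prod[of 1 1]
  proof eventually_elim
    case (elim x)
    obtain X Y where x: "x = (X, Y)" by force
    have 1: "X \<ge> 1" "Y \<ge> 1" using elim x by auto
    have "g X Y / (X * Y) \<le> f X Y / (X * Y)" "f X Y / (X * Y) \<le> h X Y / (X * Y)"
      using le[OF 1] 1 by (auto intro!: divide_right_mono)
    then show ?case using elim gh x by (auto simp: dist_real_def abs_less_iff)
  qed
qed

lemma has_density_diagonal:
  assumes "has_density f L"
  shows "(\<lambda>n. f (real n) (real n) / (real n)\<^sup>2) \<longlonglongrightarrow> L"
  using filterlim_compose[OF assms[unfolded has_density_def]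
      filterlim_Pair[OF filterlim_real_sequentially filterlim_real_sequentially]]
  by (simp add: power2_eq_square)

subsection \<open>Lattice points in regions of the unit square\<close>

text \<open>The explicit progression is what a Riemann sum needs: \<open>u0\<close> is the first
  positive member of the class from \<open>a\<close> on, \<open>u0 + m * K\<close> the first one
  past \<open>b\<close>, each within \<open>m\<close> of its end.\<close>

lemma arith_progression_in_interval:
  fixes a b :: real and m :: nat and r :: int
  assumes "m > 0" "0 \<le> a" "a \<le> b"
  obtains u0 K where
    "{u::nat. 0 < u \<and> a \<le> real u \<and> real u \<le> b \<and> [int u = r] (mod int m)} = (\<lambda>i. u0 + m * i) ` {..<K}"
    "a \<le> real u0" "real u0 \<le> a + real m" "b < real (u0 + m * K)" "real (u0 + m * K) \<le> b + real m"
proof -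
  \<comment> \<open>The maximum with 1 keeps the points positive when \<open>a\<close> is 0.\<close>
  define t where "t = max 1 (nat \<lceil>a\<rceil>)"
  have t: "u \<ge> t \<longleftrightarrow> 0 < u \<and> a \<le> real u" for u :: nat
    using assms(2) unfolding t_def by (auto simp: ceiling_le_iff nat_le_iff)
  have ta: "real t \<le> a + 1" unfolding t_def using assms(2) by (simp add: max_def)
  define u0 where "u0 = t + nat ((r - int t) mod int m)"
  have u0c: "[int u0 = r] (mod int m)"
    using assms(1) unfolding u0_def cong_def by (simp add: mod_simps)
  have u0t: "t \<le> u0" "u0 < t + m"
    using assms(1) unfolding u0_def by (auto simp: nat_less_iff)
  have u0a: "a \<le> real u0" "0 < u0" using t[of u0] u0t by auto
  have u0b: "real u0 \<le> a + real m" using ta u0t(2) by linarith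
  \<comment> \<open>If \<open>u0\<close> already exceeds \<open>b\<close>, the floor is -1 and
    \<open>K\<close> is 0.\<close>
  define K where "K = nat (\<lfloor>(b - real u0) / real m\<rfloor> + 1)"
  have K: "i < K \<longleftrightarrow> real (u0 + m * i) \<le> b" for i
  proof -
    have "i < K \<longleftrightarrow> int i \<le> \<lfloor>(b - real u0) / real m\<rfloor>" unfolding K_def by linarith
    also have "\<dots> \<longleftrightarrow> real i \<le> (b - real u0) / real m" by (simp add: le_floor_iff)
    also have "\<dots> \<longleftrightarrow> real (u0 + m * i) \<le> b" using assms(1) by (simp add: field_simps)
    finally show ?thesis .
  qed
  have "real (u0 + m * K) \<le> b + real m"
  proof (cases K)
    case 0 then show ?thesis using u0b assms(3) by simp
  next
    case (Suc k)
    with K[of k] show ?thesis by (simp add: algebra_simps)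
  qed
  moreover have "b < real (u0 + m * K)" using K[of K] by auto
  moreover have "{u::nat. 0 < u \<and> a \<le> real u \<and> real u \<le> b \<and> [int u = r] (mod int m)} = (\<lambda>i. u0 + m * i) ` {..<K}"
  proof (intro equalityI subsetI)
    fix u assume u: "u \<in> {u::nat. 0 < u \<and> a \<le> real u \<and> real u \<le> b \<and> [int u = r] (mod int m)}"
    then have "u \<ge> t" using t by blast
    have "[int u = int u0] (mod int m)" using u u0c by (auto intro: cong_trans cong_sym)
    then have dv: "int m dvd int u - int u0" by (simp add: cong_iff_dvd_diff)
    have "u \<ge> u0"
    proof (rule ccontr)
      assume "\<not> u \<ge> u0"
      then have "int u0 - int u > 0" "int u0 - int u < int m" using u0t \<open>u \<ge> t\<close> by auto
      moreover have "int m dvd int u0 - int u" using dv by (simp add: dvd_diff_commute)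
      ultimately show False using zdvd_imp_le by fastforce
    qed
    then have "m dvd u - u0" using dv by (metis of_nat_diff of_nat_dvd_iff)
    then obtain i where "u = u0 + m * i" using \<open>u \<ge> u0\<close> by (metis dvdE le_add_diff_inverse)
    then show "u \<in> (\<lambda>i. u0 + m * i) ` {..<K}" using u K by auto
  next
    fix u assume "u \<in> (\<lambda>i. u0 + m * i) ` {..<K}"
    then obtain i where i: "i < K" "u = u0 + m * i" by auto
    have "[int u = r] (mod int m)" using u0c unfolding i by (simp add: cong_def)
    moreover have "a \<le> real u" using u0a i by (simp add: add_increasing2)
    ultimately show "u \<in> {u::nat. 0 < u \<and> a \<le> real u \<and> real u \<le> b \<and> [int u = r] (mod int m)}"
      using K i u0a by auto
  qed
  ultimately show ?thesis using that u0a u0b by blast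
qed

lemma card_residue_class_interval:
  fixes a b :: real and m :: nat and r :: int
  assumes "m > 0" "0 \<le> a" "a \<le> b"
  shows "\<bar>real (card {u::nat. 0 < u \<and> a \<le> real u \<and> real u \<le> b \<and> [int u = r] (mod int m)}) - (b - a) / real m\<bar> \<le> 1"
proof -
  from arith_progression_in_interval[OF assms, of r] obtain u0 K where
    K: "{u::nat. 0 < u \<and> a \<le> real u \<and> real u \<le> b \<and> [int u = r] (mod int m)} = (\<lambda>i. u0 + m * i) ` {..<K}"
    "a \<le> real u0" "real u0 \<le> a + real m" "b < real (u0 + m * K)" "real (u0 + m * K) \<le> b + real m" .
  have "card ((\<lambda>i. u0 + m * i) ` {..<K}) = K"
    using assms(1) by (subst card_image) (auto simp: inj_on_def)
  moreover have "\<bar>real m * real K - (b - a)\<bar> \<le> real m" using K(2-5) by simp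
  then have "\<bar>(real m * real K - (b - a)) / real m\<bar> \<le> 1" using assms(1) by (simp add: field_simps)
  then have "\<bar>real K - (b - a) / real m\<bar> \<le> 1" using assms(1) by (simp add: field_simps)
  ultimately show ?thesis using K(1) by simp
qed

definition lattice_points :: "(real \<times> real) set \<Rightarrow> nat \<Rightarrow> int \<Rightarrow> int \<Rightarrow> real \<Rightarrow> real \<Rightarrow> (nat \<times> nat) set" where
  "lattice_points R m r s X Y =
     {(u, v). 0 < u \<and> 0 < v \<and> (real u / X, real v / Y) \<in> R \<and> [int u = r] (mod int m) \<and> [int v = s] (mod int m)}"

text \<open>The area enters only through this asymptotic count of lattice points.\<close>

definition region_area :: "(real \<times> real) set \<Rightarrow> real \<Rightarrow> bool" where
  "region_area R A \<longleftrightarrow> R \<subseteq> {0..1} \<times> {0..1} \<and>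
     (\<forall>m>0. \<forall>r s. has_density (\<lambda>X Y. real (card (lattice_points R m r s X Y))) (A / (real m)\<^sup>2))"

text \<open>On each step the mean value theorem writes the increment of \<open>H\<close> as
  \<open>\<delta> * h z\<close> with \<open>z\<close> inside the step, and replacing
  \<open>z\<close> by the left end costs at most \<open>L * \<delta>\<^sup>2\<close>.\<close>

lemma riemann_sum_bound:
  fixes h H :: "real \<Rightarrow> real" and x :: "nat \<Rightarrow> real"
  assumes H: "\<And>x. c \<le> x \<Longrightarrow> (H has_real_derivative h x) (at x)"
    and L: "\<And>x y. c \<le> x \<Longrightarrow> x \<le> y \<Longrightarrow> \<bar>h x - h y\<bar> \<le> L * (y - x)"
    and "c \<le> x0" "\<delta> > 0"
  shows "\<bar>(\<Sum>i<K. \<delta> * h (x0 + \<delta> * real i)) - (H (x0 + \<delta> * real K) - H x0)\<bar> \<le> L * \<delta>\<^sup>2 * real K"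
proof (induction K)
  case 0 show ?case by simp
next
  case (Suc K)
  define y where "y = x0 + \<delta> * real K"
  have y: "c \<le> y" using assms(3,4) unfolding y_def by (simp add: add_increasing2)
  obtain z where z: "y < z" "z < y + \<delta>" "H (y + \<delta>) - H y = (y + \<delta> - y) * h z"
    using MVT2[of y "y + \<delta>" H h] H y assms(4) by force
  have L0: "L \<ge> 0" using L[of y "y + 1"] y abs_ge_zero[of "h y - h (y+1)"] by simp
  have "\<bar>\<delta> * h y - (H (y + \<delta>) - H y)\<bar> = \<delta> * \<bar>h y - h z\<bar>"
    using z(3) assms(4) by (simp add: right_diff_distrib[symmetric] abs_mult)
  also have "\<dots> \<le> \<delta> * (L * \<delta>)"
    using L[of y z] y z L0 assms(4) mult_left_mono[of "z - y" \<delta> L] by (intro mult_left_mono) auto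
  finally have "\<bar>\<delta> * h y - (H (y + \<delta>) - H y)\<bar> \<le> L * \<delta>\<^sup>2" by (simp add: power2_eq_square mult_ac)
  moreover have "x0 + \<delta> * real (Suc K) = y + \<delta>" by (simp add: y_def algebra_simps)
  moreover have "(\<Sum>i<Suc K. \<delta> * h (x0 + \<delta> * real i)) = (\<Sum>i<K. \<delta> * h (x0 + \<delta> * real i)) + \<delta> * h y"
    by (simp add: y_def)
  moreover have "L * \<delta>\<^sup>2 * real (Suc K) = L * \<delta>\<^sup>2 * real K + L * \<delta>\<^sup>2" by (simp add: algebra_simps)
  ultimately show ?case using Suc unfolding y_def[symmetric] abs_le_iff by (simp only:) linarith
qed

text \<open>Counted column by column: the admissible \<open>u / X\<close> are equally spaced with
  step \<open>m / X\<close>, and each column holds \<open>h (u / X) * Y / m\<close> points up to an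
  error of 1. The total is a Riemann sum; rounding in the columns costs O(1/Y), the Riemann sum and
  its ends O(1/X). The last step ends beyond 1, whence the assumptions on \<open>h\<close> and
  \<open>H\<close> there.\<close>

lemma region_area_below_one:
  fixes h H :: "real \<Rightarrow> real"
  assumes c: "0 \<le> c" "c \<le> 1"
    and h01: "\<And>x. c \<le> x \<Longrightarrow> x \<le> 1 \<Longrightarrow> 0 \<le> h x \<and> h x \<le> 1"
    and H: "\<And>x. c \<le> x \<Longrightarrow> (H has_real_derivative h x) (at x)"
    and L: "\<And>x y. c \<le> x \<Longrightarrow> x \<le> y \<Longrightarrow> \<bar>h x - h y\<bar> \<le> L * (y - x)"
    and B: "\<And>x. c \<le> x \<Longrightarrow> x \<le> 2 \<Longrightarrow> \<bar>h x\<bar> \<le> 1"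
  shows "region_area {(x, y). c \<le> x \<and> x \<le> 1 \<and> 1 - h x \<le> y \<and> y \<le> 1} (H 1 - H c)"
    (is "region_area ?R _")
  unfolding region_area_def
proof (intro conjI allI impI)
  show "?R \<subseteq> {0..1} \<times> {0..1}" using c h01 by force
next
  fix m :: nat and r s :: int assume m: "m > 0"
  have L0: "L \<ge> 0" using L[of c "c + 1"] abs_ge_zero[of "h c - h (c+1)"] by simp
  show "has_density (\<lambda>X Y. real (card (lattice_points ?R m r s X Y))) ((H 1 - H c) / (real m)\<^sup>2)"
  proof (rule has_density_bound[of "real m" 1 _ _ "(2 * L + 2) / real m" 2])
    fix X Y :: real assume X: "X \<ge> real m" and Y: "Y \<ge> 1"
    have X0: "X > 0" using X m by linarith
    define \<delta> where "\<delta> = real m / X"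
    \<comment> \<open>Here \<open>X \<ge> m\<close> enters: steps of length at most 1 keep the end
      of the last one below 2.\<close>
    have d: "0 < \<delta>" "\<delta> \<le> 1" using X X0 m unfolding \<delta>_def by (auto simp: field_simps)
    define U where "U = {u::nat. 0 < u \<and> c * X \<le> real u \<and> real u \<le> X \<and> [int u = r] (mod int m)}"
    define V where "V u = {v::nat. 0 < v \<and> (1 - h (real u / X)) * Y \<le> real v \<and> real v \<le> Y \<and> [int v = s] (mod int m)}" for u
    have "0 \<le> c * X" "c * X \<le> X" using c X0 by auto
    from arith_progression_in_interval[OF m this, of r] obtain u0 K where
      K: "U = (\<lambda>i. u0 + m * i) ` {..<K}"
      "c * X \<le> real u0" "real u0 \<le> c * X + real m" "X < real (u0 + m * K)" "real (u0 + m * K) \<le> X + real m"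
      unfolding U_def by blast
    define x where "x = real u0 / X"
    have x: "c \<le> x" "x \<le> c + \<delta>" using K(2,3) X0 unfolding x_def \<delta>_def by (auto simp: field_simps)
    have xi: "real (u0 + m * i) / X = x + \<delta> * real i" for i
      using X0 unfolding x_def \<delta>_def by (simp add: field_simps)
    have xK: "1 \<le> x + \<delta> * real K" "x + \<delta> * real K \<le> 1 + \<delta>"
    proof -
      show "1 \<le> x + \<delta> * real K" using K(4) X0 unfolding xi[symmetric] by simp
      have "real (u0 + m * K) / X \<le> (X + real m) / X" using K(5) X0 by (intro divide_right_mono) auto
      then show "x + \<delta> * real K \<le> 1 + \<delta>"
        unfolding xi using X0 by (simp add: \<delta>_def add_divide_distrib)
    qed
    have KX: "real K \<le> 2 * X / real m"
    proof -
      have "\<delta> * real K \<le> 2" using xK(2) x(1) c d by linarith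
      then show ?thesis using X0 m unfolding \<delta>_def by (simp add: field_simps)
    qed
    have finV: "finite (V u)" for u
      by (rule finite_subset[of _ "{..nat \<lfloor>Y\<rfloor>}"]) (auto simp: V_def le_nat_floor)
    have "lattice_points ?R m r s X Y = Sigma U V"
      using X0 Y by (auto simp: lattice_points_def U_def V_def field_simps)
    then have "card (lattice_points ?R m r s X Y) = (\<Sum>u\<in>U. card (V u))"
      using finV K(1) by (simp add: card_SigmaI)
    also have "\<dots> = (\<Sum>i<K. card (V (u0 + m * i)))"
      unfolding K(1) using m by (subst sum.reindex) (auto simp: inj_on_def)
    finally have cardeq: "real (card (lattice_points ?R m r s X Y)) = (\<Sum>i<K. real (card (V (u0 + m * i))))" by simp
    have "\<bar>real (card (V (u0 + m * i))) - h (x + \<delta> * real i) * Y / real m\<bar> \<le> 1" if "i < K" for i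
    proof -
      have "u0 + m * i \<in> U" using K(1) that by auto
      then have "c \<le> x + \<delta> * real i" "x + \<delta> * real i \<le> 1"
        using X0 by (auto simp: U_def xi[symmetric] field_simps)
      then have h: "0 \<le> h (x + \<delta> * real i)" "h (x + \<delta> * real i) \<le> 1" using h01 by auto
      have "0 \<le> (1 - h (x + \<delta> * real i)) * Y" "(1 - h (x + \<delta> * real i)) * Y \<le> Y"
        using h Y by (auto simp: algebra_simps)
      from card_residue_class_interval[OF m this, of s] show ?thesis
        unfolding V_def xi by (simp add: algebra_simps)
    qed
    then have "(\<Sum>i<K. \<bar>real (card (V (u0 + m * i))) - h (x + \<delta> * real i) * Y / real m\<bar>) \<le> (\<Sum>i<K. 1)"
      by (intro sum_mono) auto
    then have e1: "\<bar>(\<Sum>i<K. real (card (V (u0 + m * i)))) - (\<Sum>i<K. h (x + \<delta> * real i) * Y / real m)\<bar> \<le> real K"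
      using sum_abs[of "\<lambda>i. real (card (V (u0 + m * i))) - h (x + \<delta> * real i) * Y / real m" "{..<K}"]
      by (simp add: sum_subtractf)
    define S where "S = (\<Sum>i<K. \<delta> * h (x + \<delta> * real i))"
    have S: "(\<Sum>i<K. h (x + \<delta> * real i) * Y / real m) / (X * Y) = S / (real m)\<^sup>2"
      using X0 Y m unfolding S_def \<delta>_def sum_divide_distrib
      by (intro sum.cong) (auto simp: field_simps power2_eq_square)
    have "\<bar>S - (H (x + \<delta> * real K) - H x)\<bar> \<le> L * \<delta>\<^sup>2 * real K"
      unfolding S_def by (rule riemann_sum_bound[OF H L]) (use x d in auto)
    also have "\<dots> \<le> 2 * L * \<delta>"
    proof -
      have "\<delta> * real K \<le> 2" using xK(2) x(1) c d by linarith
      then have "L * \<delta> * (\<delta> * real K) \<le> L * \<delta> * 2" using L0 d by (intro mult_left_mono) auto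
      then show ?thesis by (simp add: power2_eq_square mult_ac)
    qed
    finally have S1: "\<bar>S - (H (x + \<delta> * real K) - H x)\<bar> \<le> 2 * L * \<delta>" .
    \<comment> \<open>Moving an end of the range of integration by at most \<open>\<delta>\<close>
      changes \<open>H\<close> by at most \<open>\<delta>\<close>; used near \<open>c\<close> and
      near 1.\<close>
    have HB: "\<bar>H z - H w\<bar> \<le> \<delta>" if "c \<le> w" "w \<le> z" "z \<le> w + \<delta>" "w + \<delta> \<le> 2" for w z
    proof (cases "w = z")
      case False
      note wz = that
      have "w < z" using False wz by simp
      then obtain t where t: "w < t" "t < z" "H z - H w = (z - w) * h t"
        using MVT2[of w z H h] H wz by force
      have "\<bar>h t\<bar> \<le> 1" using B t wz by auto
      then have "\<bar>H z - H w\<bar> \<le> (z - w) * 1" unfolding t(3) abs_mult using wz by (intro mult_mono) auto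
      then show ?thesis using wz by simp
    qed (use d in auto)
    have "\<bar>H x - H c\<bar> \<le> \<delta>" "\<bar>H (x + \<delta> * real K) - H 1\<bar> \<le> \<delta>"
      using HB[of c x] HB[of 1 "x + \<delta> * real K"] x xK c d by auto
    then have "\<bar>S - (H 1 - H c)\<bar> \<le> (2 * L + 2) * \<delta>" using S1 by (simp add: algebra_simps)
    then have "\<bar>S - (H 1 - H c)\<bar> / (real m)\<^sup>2 \<le> (2 * L + 2) * \<delta> / (real m)\<^sup>2"
      by (rule divide_right_mono) simp
    also have "\<dots> = (2 * L + 2) / real m / X" using m X0 by (simp add: \<delta>_def power2_eq_square)
    finally have S2: "\<bar>S / (real m)\<^sup>2 - (H 1 - H c) / (real m)\<^sup>2\<bar> \<le> (2 * L + 2) / real m / X"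
      by (simp add: diff_divide_distrib[symmetric] abs_divide)
    have "\<bar>((\<Sum>i<K. real (card (V (u0 + m * i)))) - (\<Sum>i<K. h (x + \<delta> * real i) * Y / real m)) / (X * Y)\<bar>
        \<le> (2 * X / real m) / (X * Y)"
      unfolding abs_divide using e1 KX X0 Y by (intro frac_le) auto
    also have "\<dots> = 2 / (real m * Y)" using X0 by simp
    also have "\<dots> \<le> 2 / Y" using m Y by (intro divide_left_mono) auto
    finally have "\<bar>(\<Sum>i<K. real (card (V (u0 + m * i)))) / (X * Y) - S / (real m)\<^sup>2\<bar> \<le> 2 / Y"
      unfolding diff_divide_distrib S .
    then show "\<bar>real (card (lattice_points ?R m r s X Y)) / (X * Y) - (H 1 - H c) / (real m)\<^sup>2\<bar>
        \<le> (2 * L + 2) / real m / X + 2 / Y"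
      using S2 unfolding cardeq by linarith
  qed
qed

text \<open>This region describes the pairs \<open>a \<le> q\<close> and serves to count the
  fractions; \<open>x - x\<^sup>2 / 2\<close> is an antiderivative of the column height
  \<open>1 - x\<close>.\<close>

lemma region_area_triangle: "region_area {(x, y). 0 \<le> x \<and> x \<le> y \<and> y \<le> 1} (1 / 2)"
proof -
  have "region_area {(x, y). 0 \<le> x \<and> x \<le> 1 \<and> 1 - (1 - x) \<le> y \<and> y \<le> (1::real)}
      ((\<lambda>x. x - x\<^sup>2 / 2) 1 - (\<lambda>x. x - x\<^sup>2 / 2) 0)"
    by (rule region_area_below_one[where L = 1]) (auto intro!: derivative_eq_intros)
  moreover have "{(x, y). 0 \<le> x \<and> x \<le> 1 \<and> 1 - (1 - x) \<le> y \<and> y \<le> (1::real)} = {(x, y). 0 \<le> x \<and> x \<le> y \<and> y \<le> 1}"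
    by auto
  ultimately show ?thesis by simp
qed

definition hyperbola_region :: "real \<Rightarrow> (real \<times> real) set" where
  "hyperbola_region k = {(x, y). 0 \<le> x \<and> x \<le> 1 \<and> 0 \<le> y \<and> y \<le> 1 \<and> k \<le> x * y}"

definition hyperbola_area :: "real \<Rightarrow> real" where
  "hyperbola_area k = (if k \<le> 1 then 1 - k + k * ln k else 0)"

text \<open>Since \<open>y \<le> 1\<close>, the region lies over \<open>x \<ge> k\<close>, where the
  column height \<open>1 - k / x\<close> has Lipschitz constant \<open>1 / k\<close> and
  antiderivative \<open>x - k * ln x\<close>. For \<open>k > 1\<close> nothing is left of
  it.\<close>

lemma region_area_hyperbola:
  assumes "k > 0"
  shows "region_area (hyperbola_region k) (hyperbola_area k)"
proof (cases "k \<le> 1")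
  case True
  have "region_area {(x, y). k \<le> x \<and> x \<le> 1 \<and> 1 - (1 - k / x) \<le> y \<and> y \<le> (1::real)}
      ((\<lambda>x. x - k * ln x) 1 - (\<lambda>x. x - k * ln x) k)"
  proof (rule region_area_below_one[where L = "1 / k"])
    fix x y assume xy: "k \<le> x" "x \<le> y"
    have "(1 - k / x) - (1 - k / y) = - (k * (y - x) / (x * y))" using xy assms by (simp add: field_simps)
    then have "\<bar>(1 - k / x) - (1 - k / y)\<bar> = k * (y - x) / (x * y)" using xy assms by simp
    also have "\<dots> \<le> k * (y - x) / (k * k)"
      using xy assms by (intro divide_left_mono mult_mono) auto
    finally show "\<bar>(1 - k / x) - (1 - k / y)\<bar> \<le> 1 / k * (y - x)" using assms by simp
  qed (use assms True in \<open>auto intro!: derivative_eq_intros simp: field_simps\<close>)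
  moreover have "{(x, y). k \<le> x \<and> x \<le> 1 \<and> 1 - (1 - k / x) \<le> y \<and> y \<le> (1::real)} = hyperbola_region k"
  proof (intro equalityI subsetI)
    fix p assume "p \<in> {(x, y). k \<le> x \<and> x \<le> 1 \<and> 1 - (1 - k / x) \<le> y \<and> y \<le> (1::real)}"
    then show "p \<in> hyperbola_region k"
      using assms by (auto simp: hyperbola_region_def field_simps intro: order_trans[of 0 "k / _"])
        (smt (verit, best) mult_pos_neg)+
  next
    fix p assume "p \<in> hyperbola_region k"
    then obtain x y where p: "p = (x, y)" "0 \<le> x" "x \<le> 1" "0 \<le> y" "y \<le> 1" "k \<le> x * y"
      by (auto simp: hyperbola_region_def)
    have "x * y \<le> x * 1" using p by (intro mult_left_mono) auto
    then have "k \<le> x" using p by simp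
    moreover from this have "k / x \<le> y" using p assms by (simp add: field_simps)
    ultimately show "p \<in> {(x, y). k \<le> x \<and> x \<le> 1 \<and> 1 - (1 - k / x) \<le> y \<and> y \<le> (1::real)}"
      using p by auto
  qed
  ultimately show ?thesis using True by (simp add: hyperbola_area_def algebra_simps)
next
  case False
  have "x * y \<le> 1" if "0 \<le> x" "x \<le> 1" "0 \<le> y" "y \<le> 1" for x y :: real
    using mult_mono[of x 1 y 1] that by simp
  then have "hyperbola_region k = {}" using False by (force simp: hyperbola_region_def)
  then show ?thesis using False
    by (auto simp: region_area_def lattice_points_def hyperbola_area_def has_density_zero)
qed

section \<open>Finiteness and scaling of lattice points in residue classes\<close>

lemma finite_lattice_points:
  assumes "R \<subseteq> {0..1} \<times> {0..1}" "X > 0" "Y > 0"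
  shows "finite (lattice_points R m r s X Y)"
proof (rule finite_subset)
  show "lattice_points R m r s X Y \<subseteq> {..nat \<lfloor>X\<rfloor>} \<times> {..nat \<lfloor>Y\<rfloor>}"
    using assms by (force simp: lattice_points_def le_nat_floor)
qed simp

text \<open>Take for \<open>r'\<close> the product of \<open>r\<close> with an inverse of
  \<open>e\<close>. That unit classes stay unit classes lets the later induction on the determinant
  continue.\<close>

lemma residue_class_divide:
  fixes m e :: nat and r :: int
  assumes "coprime e m"
  obtains r' where "\<And>u::nat. [int (e * u) = r] (mod int m) \<longleftrightarrow> [int u = r'] (mod int m)"
    and "coprime r (int m) \<Longrightarrow> coprime r' (int m)"
proof -
  have em: "coprime (int e) (int m)" using assms by simp
  then obtain x where x: "[int e * x = 1] (mod int m)" using cong_solve_coprime_int by blast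
  have ex: "[int e * (x * r) = r] (mod int m)"
    using cong_scalar_right[OF x, of r] by (simp add: mult.assoc)
  have "[int (e * u) = r] (mod int m) \<longleftrightarrow> [int u = x * r] (mod int m)" for u :: nat
  proof -
    have "[int (e * u) = r] (mod int m) \<longleftrightarrow> [int e * int u = int e * (x * r)] (mod int m)"
      using ex by (auto intro: cong_trans cong_sym)
    also have "\<dots> \<longleftrightarrow> [int u = x * r] (mod int m)" using cong_mult_lcancel[OF em] by blast
    finally show ?thesis .
  qed
  moreover have "coprime (x * r) (int m)" if "coprime r (int m)"
  proof -
    have "coprime (int e * (x * r)) (int m)"
      using cong_imp_coprime[OF cong_sym[OF ex] that] .
    then show ?thesis using coprime_mult_left_iff by blast
  qed
  ultimately show ?thesis using that by blast
qed

text \<open>Applied to denominators: one that lies in a unit class shares no factor with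
  \<open>m\<close>, so only \<open>e\<close> coprime to \<open>m\<close> can ever be divided
  out.\<close>

lemma not_cong_if_not_coprime:
  fixes m e u :: nat and r :: int
  assumes "coprime r (int m)" "\<not> coprime e m"
  shows "\<not> [int (e * u) = r] (mod int m)"
proof
  assume "[int (e * u) = r] (mod int m)"
  then have "coprime (int (e * u)) (int m)" using assms(1) cong_imp_coprime cong_sym by blast
  then show False using assms(2) by auto
qed

lemma lattice_points_scale:
  assumes "e > 0" "f > 0"
    and "\<And>u::nat. [int (e * u) = r] (mod int m) \<longleftrightarrow> [int u = r'] (mod int m)"
    and "\<And>u::nat. [int (f * u) = s] (mod int m) \<longleftrightarrow> [int u = s'] (mod int m)"
  shows "(e * u, f * v) \<in> lattice_points R m r s X Y \<longleftrightarrow>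
    (u, v) \<in> lattice_points R m r' s' (X / real e) (Y / real f)"
  using assms(1,2) unfolding lattice_points_def mem_Collect_eq prod.case assms(3,4)
  by (simp add: mult.commute)

subsection \<open>Coprime lattice points\<close>

text \<open>Adding \<open>p\<close> to the sieve removes the points with both coordinates divisible
  by \<open>p\<close>. Division by \<open>p\<close> turns them into the points of a box shrunk by
  \<open>p\<close>, in other residue classes and still sieved by \<open>S\<close>, so the density is
  multiplied by \<open>1 - 1 / p\<^sup>2\<close>. This is why the classes are arbitrary in the
  induction.\<close>

lemma sieved_density:
  assumes R: "region_area R A" and m: "m > 0"
    and S: "finite S" "\<And>p. p \<in> S \<Longrightarrow> prime p \<and> \<not> p dvd m"
  shows "has_density (\<lambda>X Y. real (card {(u, v) \<in> lattice_points R m r s X Y. \<forall>p\<in>S. \<not> (p dvd u \<and> p dvd v)}))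
           (A / (real m)\<^sup>2 * (\<Prod>p\<in>S. 1 - 1 / (real p)\<^sup>2))"
  using S
proof (induction S arbitrary: r s rule: finite_induct)
  case empty
  then show ?case using R m by (simp add: region_area_def)
next
  case (insert p S)
  define W where "W S r s X Y = {(u, v) \<in> lattice_points R m r s X Y. \<forall>p\<in>S. \<not> (p dvd u \<and> p dvd v)}" for S r s X Y
  have p: "prime p" "\<not> p dvd m" "p > 0" using insert.prems[of p] prime_gt_0_nat by auto
  have pm: "coprime p m" using p by (simp add: prime_imp_coprime)
  obtain r' where r': "\<And>u::nat. [int (p * u) = r] (mod int m) \<longleftrightarrow> [int u = r'] (mod int m)"
    using residue_class_divide[OF pm] by blast
  obtain s' where s': "\<And>u::nat. [int (p * u) = s] (mod int m) \<longleftrightarrow> [int u = s'] (mod int m)"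
    using residue_class_divide[OF pm] by blast
  have dvd_iff: "q dvd p * u \<longleftrightarrow> q dvd u" if "q \<in> S" for q u
  proof -
    have "coprime q p" using that insert.prems[of q] p insert.hyps by (intro primes_coprime) auto
    then show ?thesis by (simp add: coprime_dvd_mult_right_iff)
  qed
  have IH: "has_density (\<lambda>X Y. real (card (W S r s X Y))) (A / (real m)\<^sup>2 * (\<Prod>p\<in>S. 1 - 1 / (real p)\<^sup>2))" for r s
    unfolding W_def using insert.IH insert.prems by blast
  have eq: "real (card (W S r s X Y)) - real (card (W S r' s' (X / real p) (Y / real p))) =
      real (card (W (insert p S) r s X Y))" if XY: "X \<ge> 1" "Y \<ge> 1" for X Y
  proof -
    let ?f = "\<lambda>(u, v). (p * u, p * v)"
    have fin: "finite (W S r s X Y)" for S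
      by (rule finite_subset[OF _ finite_lattice_points[of R X Y m r s]])
        (use R XY in \<open>auto simp: W_def region_area_def\<close>)
    have 1: "W S r s X Y = W (insert p S) r s X Y \<union> ?f ` W S r' s' (X / real p) (Y / real p)"
    proof (intro equalityI subsetI)
      fix x assume x: "x \<in> W S r s X Y"
      obtain u v where uv: "x = (u, v)" by force
      show "x \<in> W (insert p S) r s X Y \<union> ?f ` W S r' s' (X / real p) (Y / real p)"
      proof (cases "p dvd u \<and> p dvd v")
        case True
        then obtain u' v' where "u = p * u'" "v = p * v'" by (auto elim!: dvdE)
        then have "x = ?f (u', v')" "(u', v') \<in> W S r' s' (X / real p) (Y / real p)"
          using x uv lattice_points_scale[OF p(3) p(3) r' s', of u' v' R X Y] by (auto simp: W_def dvd_iff)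
        then show ?thesis by blast
      qed (use x uv in \<open>auto simp: W_def\<close>)
    next
      fix x assume "x \<in> W (insert p S) r s X Y \<union> ?f ` W S r' s' (X / real p) (Y / real p)"
      then show "x \<in> W S r s X Y"
        using lattice_points_scale[OF p(3) p(3) r' s', of _ _ R X Y] by (auto simp: W_def dvd_iff)
    qed
    have 2: "W (insert p S) r s X Y \<inter> ?f ` W S r' s' (X / real p) (Y / real p) = {}" by (auto simp: W_def)
    have 3: "card (?f ` W S r' s' (X / real p) (Y / real p)) = card (W S r' s' (X / real p) (Y / real p))"
      using p by (intro card_image) (auto simp: inj_on_def)
    have "finite (?f ` W S r' s' (X / real p) (Y / real p))" using fin[of S] unfolding 1 by simp
    then have "card (W S r s X Y) = card (W (insert p S) r s X Y) + card (W S r' s' (X / real p) (Y / real p))"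
      unfolding 3[symmetric] by (subst 1) (intro card_Un_disjoint fin 2)
    then show ?thesis by simp
  qed
  have "has_density (\<lambda>X Y. real (card (W S r s X Y)) - real (card (W S r' s' (X / real p) (Y / real p))))
      (A / (real m)\<^sup>2 * (\<Prod>p\<in>S. 1 - 1 / (real p)\<^sup>2) - A / (real m)\<^sup>2 * (\<Prod>p\<in>S. 1 - 1 / (real p)\<^sup>2) / (real p * real p))"
    using p by (intro has_density_diff IH has_density_scale[OF IH]) auto
  then have "has_density (\<lambda>X Y. real (card (W (insert p S) r s X Y)))
      (A / (real m)\<^sup>2 * (\<Prod>p\<in>S. 1 - 1 / (real p)\<^sup>2) - A / (real m)\<^sup>2 * (\<Prod>p\<in>S. 1 - 1 / (real p)\<^sup>2) / (real p * real p))"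
    by (rule has_density_cong[OF _ eq])
  moreover have "A / (real m)\<^sup>2 * (\<Prod>p\<in>S. 1 - 1 / (real p)\<^sup>2) - A / (real m)\<^sup>2 * (\<Prod>p\<in>S. 1 - 1 / (real p)\<^sup>2) / (real p * real p)
      = A / (real m)\<^sup>2 * (\<Prod>p\<in>insert p S. 1 - 1 / (real p)\<^sup>2)"
    using insert.hyps by (simp add: algebra_simps power2_eq_square)
  ultimately show ?case unfolding W_def by simp
qed

section \<open>The tail of the sieve and the Euler product\<close>

lemma sum_inverse_squares_tail:
  assumes "z > 0"
  shows "(\<Sum>p\<in>{z<..n}. 1 / (real p)\<^sup>2) \<le> 1 / real z"
proof -
  \<comment> \<open>The subtracted \<open>1 / n\<close> makes the bound telescope.\<close>
  have "(\<Sum>p\<in>{z<..n}. 1 / (real p)\<^sup>2) \<le> 1 / real z - 1 / real n" if "n \<ge> z"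
    using that
  proof (induction n rule: dec_induct)
    case (step n)
    have "{z<..Suc n} = insert (Suc n) {z<..n}" using step by auto
    moreover have "1 / (real (Suc n))\<^sup>2 \<le> 1 / real n - 1 / real (Suc n)"
    proof -
      have "n > 0" using step.hyps assms by simp
      then have "1 / real n - 1 / real (Suc n) = 1 / (real n * real (Suc n))" by (simp add: field_simps)
      also have "\<dots> \<ge> 1 / (real (Suc n))\<^sup>2"
        using \<open>n > 0\<close> unfolding power2_eq_square by (intro divide_left_mono mult_right_mono) auto
      finally show ?thesis .
    qed
    ultimately show ?case using step.IH by simp
  qed simp
  then show ?thesis using assms by (cases "n \<ge> z") (auto intro: order_trans)
qed

text \<open>The reciprocal of zeta(2) with the factors at the primes dividing \<open>m\<close> left
  out; \<open>C_const m\<close> is \<open>totient m / m\<close> times it.\<close>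

definition euler_factor :: "nat \<Rightarrow> real" where
  "euler_factor m = (\<Prod>p. if prime p \<and> \<not> p dvd m then 1 - 1 / (real p)\<^sup>2 else 1)"

lemma euler_factor_terms:
  fixes m :: nat
  defines "f \<equiv> \<lambda>p. if prime p \<and> \<not> p dvd m then 1 - 1 / (real p)\<^sup>2 else 1"
  shows "convergent_prod f" and "\<And>p. f p > 0"
proof -
  have "summable (\<lambda>p. norm (f p - 1))"
  proof (rule summable_comparison_test')
    show "summable (\<lambda>n. inverse (real n ^ 2))" by (rule inverse_power_summable) simp
    show "norm (norm (f n - 1)) \<le> inverse (real n ^ 2)" if "n \<ge> 0" for n
      by (simp add: f_def field_simps)
  qed
  then show "convergent_prod f"
    by (intro abs_convergent_prod_imp_convergent_prod) (simp add: abs_convergent_prod_conv_summable)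
  show "f p > 0" for p
  proof (cases "prime p \<and> \<not> p dvd m")
    case True
    then have "1 < (real p)\<^sup>2" using prime_gt_1_nat[of p] by (intro one_less_power) auto
    then show ?thesis using True by (auto simp: f_def divide_less_eq_1)
  qed (auto simp: f_def)
qed

lemma euler_factor_pos: "euler_factor m > 0"
  unfolding euler_factor_def using euler_factor_terms by (rule less_0_prodinf)

lemma euler_factor_LIMSEQ:
  "(\<lambda>z. \<Prod>p | p \<le> z \<and> prime p \<and> \<not> p dvd m. 1 - 1 / (real p)\<^sup>2) \<longlonglongrightarrow> euler_factor m"
proof -
  have "(\<Prod>p\<le>z. if prime p \<and> \<not> p dvd m then 1 - 1 / (real p)\<^sup>2 else 1) =
      (\<Prod>p | p \<le> z \<and> prime p \<and> \<not> p dvd m. 1 - 1 / (real p)\<^sup>2)" for z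
    by (subst prod.inter_filter[symmetric]) (auto intro!: prod.cong)
  then show ?thesis
    using convergent_prod_LIMSEQ[OF euler_factor_terms(1)[of m]] unfolding euler_factor_def by simp
qed

text \<open>Sieving up to \<open>z\<close> bounds the count from above. What it misses are points
  with a common prime factor \<open>p > z\<close>, at most \<open>X * Y / p\<^sup>2\<close> for each
  \<open>p\<close> and \<open>X * Y / z\<close> in total. Primes dividing \<open>m\<close> need no
  sieving because \<open>v\<close> lies in a unit class; \<open>r\<close> stays arbitrary since
  numerators run through all classes.\<close>

lemma coprime_density:
  assumes R: "region_area R A" and m: "m > 0" and s: "coprime s (int m)"
  shows "has_density (\<lambda>X Y. real (card {(u, v) \<in> lattice_points R m r s X Y. coprime u v}))
           (A * euler_factor m / (real m)\<^sup>2)"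
proof (rule has_density_sandwich)
  fix \<epsilon> :: real assume e: "\<epsilon> > 0"
  define S where "S z = {p::nat. p \<le> z \<and> prime p \<and> \<not> p dvd m}" for z
  define E where "E z = A / (real m)\<^sup>2 * (\<Prod>p\<in>S z. 1 - 1 / (real p)\<^sup>2)" for z
  have "E \<longlonglongrightarrow> A / (real m)\<^sup>2 * euler_factor m"
    unfolding E_def S_def by (intro tendsto_mult_left euler_factor_LIMSEQ)
  then have "eventually (\<lambda>z. dist (E z) (A / (real m)\<^sup>2 * euler_factor m) < \<epsilon> / 2) sequentially"
    using e by (intro tendstoD) auto
  moreover have "eventually (\<lambda>z. inverse (real z) < \<epsilon> / 2) sequentially"
    using order_tendstoD(2)[OF lim_inverse_n[where ?'a = real], of "\<epsilon> / 2"] e by simp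
  ultimately have "eventually (\<lambda>z. \<bar>E z - A * euler_factor m / (real m)\<^sup>2\<bar> < \<epsilon> / 2 \<and> 1 / real z < \<epsilon> / 2 \<and> z > 0) sequentially"
    using eventually_gt_at_top[of 0] by eventually_elim (auto simp: dist_real_def inverse_eq_divide)
  \<comment> \<open>The sieve level makes both the missing Euler factors and the tail
    \<open>1 / z\<close> cost less than \<open>\<epsilon> / 2\<close>.\<close>
  then obtain z where z: "\<bar>E z - A * euler_factor m / (real m)\<^sup>2\<bar> < \<epsilon> / 2" "1 / real z < \<epsilon> / 2" "z > 0"
    using eventually_happens'[OF sequentially_bot] by blast
  define W where "W X Y = {(u, v) \<in> lattice_points R m r s X Y. \<forall>p\<in>S z. \<not> (p dvd u \<and> p dvd v)}" for X Y
  define P where "P X Y = {(u, v) \<in> lattice_points R m r s X Y. coprime u v}" for X Y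
  have W: "has_density (\<lambda>X Y. real (card (W X Y))) (E z)"
    unfolding W_def E_def by (rule sieved_density[OF R m]) (auto simp: S_def)
  have c: "has_density (\<lambda>X Y. X * Y * (1 / real z)) (1 / real z)"
    by (rule has_density_bound[of 1 1 _ _ 0 0]) auto
  have le: "real (card (W X Y)) - X * Y * (1 / real z) \<le> real (card (P X Y)) \<and> real (card (P X Y)) \<le> real (card (W X Y))"
    if XY: "X \<ge> 1" "Y \<ge> 1" for X Y
  proof
    have fin: "finite (lattice_points R m r s X Y)"
      using finite_lattice_points R XY by (auto simp: region_area_def)
    have finW: "finite (W X Y)" by (rule finite_subset[OF _ fin]) (auto simp: W_def)
    have finP: "finite (P X Y)" by (rule finite_subset[OF _ fin]) (auto simp: P_def)
    have "P X Y \<subseteq> W X Y"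
      unfolding P_def W_def S_def by (auto dest: coprime_common_divisor_nat)
    then show "real (card (P X Y)) \<le> real (card (W X Y))" using finW by (simp add: card_mono)
    \<comment> \<open>A prime dividing \<open>u \<le> X\<close> is at most \<open>n\<close>, so
      finitely many \<open>T p\<close> cover the sieved points that are not coprime.
      \<open>T p\<close> ignores the residue classes, which only enlarges it.\<close>
    define n where "n = nat \<lfloor>X\<rfloor>"
    define T where "T p = (\<lambda>(i, j). (p * i, p * j)) ` ({1..nat \<lfloor>X / real p\<rfloor>} \<times> {1..nat \<lfloor>Y / real p\<rfloor>})" for p
    have "W X Y \<subseteq> P X Y \<union> (\<Union>p\<in>{z<..n}. T p)"
    proof
      fix x assume "x \<in> W X Y"
      then obtain u v where x: "x = (u, v)" and uv: "(u, v) \<in> lattice_points R m r s X Y"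
        and np: "\<And>p. p \<in> S z \<Longrightarrow> \<not> (p dvd u \<and> p dvd v)" by (auto simp: W_def)
      show "x \<in> P X Y \<union> (\<Union>p\<in>{z<..n}. T p)"
      proof (cases "coprime u v")
        case False
        then have "gcd u v \<noteq> 1" by (metis coprime_iff_gcd_eq_1)
        then obtain p where p: "prime p" "p dvd gcd u v" using prime_factor_nat by blast
        then have pd: "p dvd u" "p dvd v" by auto
        have uv0: "0 < u" "0 < v" "real u \<le> X" "real v \<le> Y" "[int v = s] (mod int m)"
          using uv R XY by (auto simp: lattice_points_def region_area_def)
        have "\<not> p dvd m"
        proof
          assume "p dvd m"
          moreover have "coprime (int v) (int m)" using uv0(5) s cong_imp_coprime cong_sym by blast
          then have "coprime v m" by simp
          ultimately show False using pd p(1) coprime_common_divisor_nat[of v m p] by auto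
        qed
        then have "p > z" using np[of p] p pd by (force simp: S_def)
        have "p \<le> u" using pd uv0 by (simp add: dvd_imp_le)
        then have "p \<le> n" using uv0 unfolding n_def by (simp add: le_nat_floor)
        obtain i j where ij: "u = p * i" "v = p * j" using pd by (auto elim!: dvdE)
        have "real i \<le> X / real p" "real j \<le> Y / real p"
          using uv0 prime_gt_0_nat[OF p(1)] unfolding ij by (auto simp: field_simps)
        then have "x \<in> T p" using uv0 unfolding T_def x ij by (auto simp: image_iff le_nat_floor)
        then show ?thesis using \<open>p > z\<close> \<open>p \<le> n\<close> by auto
      qed (use x uv in \<open>auto simp: P_def\<close>)
    qed
    moreover have "finite (T p)" for p by (simp add: T_def)
    ultimately have "card (W X Y) \<le> card (P X Y \<union> (\<Union>p\<in>{z<..n}. T p))"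
      using finP by (intro card_mono) auto
    also have "\<dots> \<le> card (P X Y) + (\<Sum>p\<in>{z<..n}. card (T p))"
      by (rule order_trans[OF card_Un_le]) (intro add_left_mono card_UN_le, simp)
    finally have "real (card (W X Y)) \<le> real (card (P X Y)) + (\<Sum>p\<in>{z<..n}. real (card (T p)))"
      by (metis of_nat_add of_nat_le_iff of_nat_sum)
    also have "(\<Sum>p\<in>{z<..n}. real (card (T p))) \<le> (\<Sum>p\<in>{z<..n}. X * Y * (1 / (real p)\<^sup>2))"
    proof (rule sum_mono)
      fix p
      have "card (T p) \<le> nat \<lfloor>X / real p\<rfloor> * nat \<lfloor>Y / real p\<rfloor>"
        unfolding T_def by (rule order_trans[OF card_image_le]) auto
      then have "real (card (T p)) \<le> real (nat \<lfloor>X / real p\<rfloor>) * real (nat \<lfloor>Y / real p\<rfloor>)"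
        by (metis of_nat_le_iff of_nat_mult)
      also have "\<dots> \<le> (X / real p) * (Y / real p)"
        using XY by (intro mult_mono) auto
      finally show "real (card (T p)) \<le> X * Y * (1 / (real p)\<^sup>2)" by (simp add: power2_eq_square)
    qed
    also have "\<dots> = X * Y * (\<Sum>p\<in>{z<..n}. 1 / (real p)\<^sup>2)" by (rule sum_distrib_left[symmetric])
    also have "\<dots> \<le> X * Y * (1 / real z)"
      using XY sum_inverse_squares_tail[OF z(3)] by (intro mult_left_mono) auto
    finally show "real (card (W X Y)) - X * Y * (1 / real z) \<le> real (card (P X Y))" by simp
  qed
  show "\<exists>g h G H. has_density g G \<and> has_density h H \<and> A * euler_factor m / (real m)\<^sup>2 - \<epsilon> \<le> G \<and>
      H \<le> A * euler_factor m / (real m)\<^sup>2 + \<epsilon> \<and>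
      (\<forall>X\<ge>1. \<forall>Y\<ge>1. g X Y \<le> real (card {(u, v) \<in> lattice_points R m r s X Y. coprime u v}) \<and>
         real (card {(u, v) \<in> lattice_points R m r s X Y. coprime u v}) \<le> h X Y)"
    unfolding P_def[symmetric]
  proof (rule exI, rule exI, rule exI, rule exI, intro conjI allI impI)
    show "has_density (\<lambda>X Y. real (card (W X Y)) - X * Y * (1 / real z)) (E z - 1 / real z)"
      by (rule has_density_diff[OF W c])
    show "A * euler_factor m / (real m)\<^sup>2 - \<epsilon> \<le> E z - 1 / real z"
      "E z \<le> A * euler_factor m / (real m)\<^sup>2 + \<epsilon>"
      using z by linarith+
  qed (use W le in auto)
qed

section \<open>Counting over full periods, and a totient identity\<close>

lemma card_periodic:
  fixes n d :: nat
  assumes "\<And>x. P (x + n) \<longleftrightarrow> P x"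
  shows "card {x\<in>{0<..d * n}. P x} = d * card {x\<in>{0<..n}. P x}"
proof (induction d)
  case (Suc d)
  have P: "P (d * n + x) \<longleftrightarrow> P x" for x
  proof (induction d)
    case (Suc d) then show ?case using assms[of "d * n + x"] by (simp add: algebra_simps)
  qed simp
  define A where "A = {x\<in>{0<..d * n}. P x}"
  define B where "B = {x\<in>{0<..n}. P x}"
  have un: "{x\<in>{0<..Suc d * n}. P x} = A \<union> (+) (d * n) ` B"
  proof (intro equalityI subsetI)
    fix x assume x: "x \<in> {x\<in>{0<..Suc d * n}. P x}"
    show "x \<in> A \<union> (+) (d * n) ` B"
    proof (cases "x \<le> d * n")
      case False
      then obtain y where "x = d * n + y" "y > 0" by (metis less_imp_add_positive not_le)
      then show ?thesis using x P by (auto simp: B_def)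
    qed (use x in \<open>auto simp: A_def\<close>)
  qed (auto simp: P A_def B_def)
  have "A \<inter> (+) (d * n) ` B = {}" "finite A" "finite B" by (auto simp: A_def B_def)
  then have "card (A \<union> (+) (d * n) ` B) = card A + card ((+) (d * n) ` B)"
    by (intro card_Un_disjoint) auto
  moreover have "card ((+) (d * n) ` B) = card B" by (rule card_image) simp
  ultimately show ?case using Suc.IH unfolding un A_def[symmetric] B_def[symmetric] by simp
qed simp

lemma card_residue_class_period:
  fixes n :: nat and r :: int
  assumes "n > 0"
  shows "card {x\<in>{0<..n}. [int x = r] (mod int n)} = 1"
proof -
  \<comment> \<open>Representatives run from 1 to \<open>n\<close>, with \<open>n\<close> standing
    for the class of 0; hence the shift by 1 before and after the reduction.\<close>
  have "{x\<in>{0<..n}. [int x = r] (mod int n)} = {nat ((r - 1) mod int n) + 1}"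
  proof (intro equalityI subsetI)
    fix x assume "x \<in> {x\<in>{0<..n}. [int x = r] (mod int n)}"
    then have x: "0 < x" "x \<le> n" "[int x = r] (mod int n)" by auto
    have "[int x - 1 = r - 1] (mod int n)" using x(3) by (intro cong_diff) auto
    then have "(r - 1) mod int n = int x - 1" using x by (simp add: cong_def)
    then show "x \<in> {nat ((r - 1) mod int n) + 1}" using x by simp
  next
    fix x assume "x \<in> {nat ((r - 1) mod int n) + 1}"
    then have x: "int x = (r - 1) mod int n + 1" using assms by simp
    moreover have "(r - 1) mod int n \<ge> 0" "(r - 1) mod int n < int n" using assms by auto
    moreover have "[int x = r] (mod int n)" unfolding x by (simp add: cong_def mod_simps)
    ultimately show "x \<in> {x\<in>{0<..n}. [int x = r] (mod int n)}" by auto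
  qed
  then show ?thesis by simp
qed

text \<open>Generalizes the classical sum of \<open>totient (N div f)\<close> over the divisors of
  \<open>N\<close>, the case \<open>m = 1\<close>. The numbers up to \<open>N * m\<close> coprime to
  \<open>m\<close> are counted twice: as \<open>N\<close> full periods, and by their gcd
  \<open>f\<close> with \<open>N * m\<close>, which is coprime to \<open>m\<close> and therefore
  divides \<open>N\<close>.\<close>

lemma totient_sum_coprime_divisors:
  fixes N m :: nat
  assumes "N > 0" "m > 0"
  shows "(\<Sum>f | f dvd N \<and> coprime f m. totient (N div f * m)) = N * totient m"
proof -
  define B where "B = {x\<in>{0<..N * m}. coprime x m}"
  define I where "I = {f. f dvd N \<and> coprime f m}"
  have finI: "finite I" unfolding I_def using assms(1) by auto
  have "card B = N * card {x\<in>{0<..m}. coprime x m}"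
    unfolding B_def by (rule card_periodic) (metis coprime_iff_gcd_eq_1 gcd_add1)
  also have "{x\<in>{0<..m}. coprime x m} = totatives m" by (auto simp: totatives_def)
  finally have 1: "card B = N * totient m" by (simp add: totient_def)
  have "card B = (\<Sum>f\<in>I. card {x\<in>B. gcd x (N * m) = f})"
  proof -
    have "(\<lambda>x. gcd x (N * m)) ` B \<subseteq> I"
    proof
      fix f assume "f \<in> (\<lambda>x. gcd x (N * m)) ` B"
      then obtain x where x: "coprime x m" "f = gcd x (N * m)" by (auto simp: B_def)
      have "f dvd x" "f dvd N * m" using x by auto
      then have "coprime f m" using x(1) coprime_divisors dvd_refl by blast
      with \<open>f dvd N * m\<close> show "f \<in> I" by (simp add: I_def coprime_dvd_mult_left_iff)
    qed
    then have "sum (\<lambda>f. sum (\<lambda>_. 1::nat) {x\<in>B. gcd x (N * m) = f}) I = sum (\<lambda>_. 1) B"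
      using finI by (intro sum.group) (auto simp: B_def)
    then show ?thesis by simp
  qed
  also have "\<dots> = (\<Sum>f\<in>I. totient (N div f * m))"
  proof (rule sum.cong)
    fix f assume f: "f \<in> I"
    have "{x\<in>B. gcd x (N * m) = f} = {x\<in>{0<..N * m}. gcd x (N * m) = f}"
    proof -
      have "coprime x m" if "gcd x (N * m) = f" for x
      proof (rule coprimeI)
        fix c assume "c dvd x" "c dvd m"
        then have "c dvd f" using that by auto
        then show "is_unit c" using f \<open>c dvd m\<close> by (auto simp: I_def dest: coprime_common_divisor)
      qed
      then show ?thesis by (auto simp: B_def)
    qed
    moreover have "f dvd N * m" "N * m div f = N div f * m"
      using f by (auto simp: I_def div_mult_swap mult.commute[of _ m])
    ultimately show "card {x\<in>B. gcd x (N * m) = f} = totient (N div f * m)"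
      using card_gcd_eq_totient[of "N * m" f] assms by simp
  qed simp
  finally show ?thesis using 1 unfolding I_def by simp
qed

text \<open>The range of \<open>(gcd a q, gcd a' q')\<close> for solutions of determinant
  \<open>D\<close>: the product of the two divides \<open>D\<close>, and divisors of a denominator
  in a unit class are coprime to \<open>m\<close>.\<close>

definition coprime_divisor_pairs :: "nat \<Rightarrow> nat \<Rightarrow> (nat \<times> nat) set" where
  "coprime_divisor_pairs m D = {(e, f). e * f dvd D \<and> coprime e m \<and> coprime f m}"

lemma finite_coprime_divisor_pairs:
  assumes "D > 0" shows "finite (coprime_divisor_pairs m D)"
proof (rule finite_subset)
  show "coprime_divisor_pairs m D \<subseteq> {d. d dvd D} \<times> {d. d dvd D}"
    by (auto simp: coprime_divisor_pairs_def dest: dvd_mult_left dvd_mult_right)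
qed (use assms in auto)

text \<open>This is \<open>\<phi>(D') / D'\<close>, where \<open>D'\<close> is the largest divisor of \<open>D\<close> that is coprime to \<open>m\<close>.\<close>

definition delta_density :: "nat \<Rightarrow> nat \<Rightarrow> real" where
  "delta_density m D = real (totient (D * m)) / (real (totient m) * real D)"

text \<open>This recursion characterizes \<open>delta_density\<close>: the left side sorts solutions
  by their two gcds, the right side is the density of all solutions. For fixed \<open>e\<close>, the
  sum over \<open>f\<close> collapses to \<open>1 / e\<close> by the totient identity for
  \<open>D div e\<close>.\<close>

lemma sum_delta_density:
  assumes "D > 0" "m > 0"
  shows "(\<Sum>(e, f)\<in>coprime_divisor_pairs m D. delta_density m (D div (e * f)) / (real e * real f)) =
         (\<Sum>d | d dvd D \<and> coprime d m. 1 / real d)"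
proof -
  have "(\<Sum>(e, f)\<in>coprime_divisor_pairs m D. delta_density m (D div (e * f)) / (real e * real f)) =
      (\<Sum>(e, f)\<in>coprime_divisor_pairs m D. real (totient (D div e div f * m)) / (real (totient m) * real D))"
  proof (rule sum.cong, goal_cases)
    case (2 x)
    then obtain e f where x: "x = (e, f)" "e * f dvd D" by (auto simp: coprime_divisor_pairs_def)
    then obtain n where n: "D = e * f * n" by (auto elim: dvdE)
    have "e > 0" "f > 0" "n > 0" using assms(1) n by auto
    then have "D div (e * f) = n" "D div e div f = n" by (auto simp: n mult.assoc)
    then show ?case unfolding x(1) by (simp add: delta_density_def n field_simps)
  qed simp
  also have "\<dots> = (\<Sum>(e, f)\<in>Sigma {e. e dvd D \<and> coprime e m} (\<lambda>e. {f. f dvd D div e \<and> coprime f m}).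
        real (totient (D div e div f * m)) / (real (totient m) * real D))"
  proof (rule sum.cong)
    show "coprime_divisor_pairs m D =
      Sigma {e. e dvd D \<and> coprime e m} (\<lambda>e. {f. f dvd D div e \<and> coprime f m})"
    proof -
      have "e * f dvd D \<longleftrightarrow> e dvd D \<and> f dvd D div e" for e f
      proof (cases "e dvd D")
        case True
        then have "e \<noteq> 0" using assms(1) by auto
        with True show ?thesis by (metis dvd_div_iff_mult mult.commute)
      qed (auto dest: dvd_mult_left)
      then show ?thesis by (auto simp: coprime_divisor_pairs_def)
    qed
  qed simp
  also have "(\<Sum>(e, f)\<in>Sigma {e. e dvd D \<and> coprime e m} (\<lambda>e. {f. f dvd D div e \<and> coprime f m}).
        real (totient (D div e div f * m)) / (real (totient m) * real D)) =
      (\<Sum>e | e dvd D \<and> coprime e m. \<Sum>f | f dvd D div e \<and> coprime f m.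
        real (totient (D div e div f * m)) / (real (totient m) * real D))"
    using assms(1) by (subst sum.Sigma) (auto simp: dvd_div_eq_0_iff)
  also have "\<dots> = (\<Sum>d | d dvd D \<and> coprime d m. 1 / real d)"
  proof (rule sum.cong, goal_cases)
    case (2 e)
    then obtain n where n: "D = e * n" by (auto elim: dvdE)
    have pos: "e > 0" "n > 0" using n assms by auto
    then have "D div e = n" by (simp add: n)
    then have "(\<Sum>f | f dvd D div e \<and> coprime f m. real (totient (D div e div f * m))) = real (n * totient m)"
      unfolding totient_sum_coprime_divisors[OF pos(2) assms(2), symmetric] by simp
    then show ?case using pos assms by (simp add: sum_divide_distrib[symmetric] n)
  qed simp
  finally show ?thesis .
qed

subsection \<open>Pairs of fractions with a given determinant\<close>

text \<open>After division by \<open>d = gcd q q'\<close> the coefficient is a unit modulo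
  \<open>q div d\<close>, so there is one solution per period, and the range of \<open>a\<close>
  consists of \<open>d\<close> periods.\<close>

lemma card_linear_congruence:
  fixes q q' D :: nat
  assumes "q > 0"
  shows "card {a. 0 < a \<and> a \<le> q \<and> q dvd D + a * q'} = (if gcd q q' dvd D then gcd q q' else 0)"
proof (cases "gcd q q' dvd D")
  case False
  have "\<not> q dvd D + a * q'" for a
  proof
    assume "q dvd D + a * q'"
    then have "gcd q q' dvd D + a * q'" using dvd_trans gcd_dvd1 by blast
    then have "gcd q q' dvd D" by (metis dvd_add_left_iff dvd_mult gcd_dvd2)
    then show False using False by simp
  qed
  then show ?thesis using False by simp
next
  case True
  define d where "d = gcd q q'"
  have d: "d > 0" using assms by (simp add: d_def)
  obtain n n' where n: "q = d * n" "q' = d * n'" "coprime n n'"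
    using gcd_coprime_exists[of q q'] assms unfolding d_def by (metis gcd_eq_0_iff less_irrefl mult.commute)
  obtain k where k: "D = d * k" using True unfolding d_def by (auto elim: dvdE)
  have n0: "n > 0" using assms n by simp
  have "coprime (int n') (int n)" using n(3) by (simp add: coprime_commute)
  then obtain x where x: "[int n' * x = 1] (mod int n)" using cong_solve_coprime_int by blast
  have iff: "q dvd D + a * q' \<longleftrightarrow> [int a = - (int k * x)] (mod int n)" for a
  proof -
    have "q dvd D + a * q' \<longleftrightarrow> n dvd k + a * n'"
    proof -
      have "D + a * q' = d * (k + a * n')" by (simp add: k n algebra_simps)
      then show ?thesis using d unfolding n(1) by simp
    qed
    also have "\<dots> \<longleftrightarrow> int n dvd int k + int a * int n'" by (metis of_nat_add of_nat_dvd_iff of_nat_mult)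
    also have "\<dots> \<longleftrightarrow> [int n' * int a = - int k] (mod int n)"
      by (simp add: cong_iff_dvd_diff algebra_simps)
    also have "\<dots> \<longleftrightarrow> [int n' * int a = int n' * (- (int k * x))] (mod int n)"
    proof -
      have "[int n' * (- (int k * x)) = - int k] (mod int n)"
        using cong_scalar_right[OF x, of "- int k"] by (simp add: algebra_simps)
      then show ?thesis by (meson cong_trans cong_sym)
    qed
    also have "\<dots> \<longleftrightarrow> [int a = - (int k * x)] (mod int n)"
      using cong_mult_lcancel[OF \<open>coprime (int n') (int n)\<close>] .
    finally show ?thesis .
  qed
  have "{a. 0 < a \<and> a \<le> q \<and> q dvd D + a * q'} = {a\<in>{0<..d * n}. [int a = - (int k * x)] (mod int n)}"
    unfolding iff by (auto simp: n(1))
  also have "card \<dots> = d * 1"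
    unfolding card_residue_class_period[OF n0, of "- (int k * x)", symmetric]
    by (rule card_periodic) (simp add: cong_def)
  finally show ?thesis using True by (simp add: d_def)
qed

text \<open>
  A triple \<open>((q, q'), a)\<close> stands for the pair of fractions \<open>a / q\<close> and \<open>a' / q'\<close> with
  \<open>a' q - a q' = D\<close>; the numerator \<open>a' = (D + a q') div q\<close> may exceed \<open>q'\<close>.
\<close>

definition solution_triples :: "(real \<times> real) set \<Rightarrow> nat \<Rightarrow> int \<Rightarrow> int \<Rightarrow> nat \<Rightarrow> real \<Rightarrow> real \<Rightarrow> ((nat \<times> nat) \<times> nat) set" where
  "solution_triples R m r s D X Y = Sigma (lattice_points R m r s X Y)
     (\<lambda>(q, q'). {a. 0 < a \<and> a \<le> q \<and> q dvd D + a * q'})"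

definition farey_triples :: "(real \<times> real) set \<Rightarrow> nat \<Rightarrow> int \<Rightarrow> int \<Rightarrow> nat \<Rightarrow> real \<Rightarrow> real \<Rightarrow> ((nat \<times> nat) \<times> nat) set" where
  "farey_triples R m r s D X Y = {((q, q'), a) \<in> solution_triples R m r s D X Y.
     coprime a q \<and> coprime ((D + a * q') div q) q'}"

lemma finite_solution_triples:
  assumes "R \<subseteq> {0..1} \<times> {0..1}" "X > 0" "Y > 0"
  shows "finite (solution_triples R m r s D X Y)"
  unfolding solution_triples_def
  using assms by (intro finite_SigmaI finite_lattice_points) auto

lemma card_group:
  assumes "finite A" "finite I" "k ` A \<subseteq> I"
  shows "card A = (\<Sum>i\<in>I. card {x\<in>A. k x = i})"
  using sum.group[OF assms, of "\<lambda>_. 1::nat"] by simp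

text \<open>The quotient classes are chosen as a function of \<open>e\<close>, so that they can
  appear inside sums over \<open>e\<close>.\<close>

lemma residue_quotients:
  fixes m :: nat and r :: int
  obtains \<rho> where "\<And>e u::nat. coprime e m \<Longrightarrow> [int (e * u) = r] (mod int m) \<longleftrightarrow> [int u = \<rho> e] (mod int m)"
    and "\<And>e. coprime e m \<Longrightarrow> coprime r (int m) \<Longrightarrow> coprime (\<rho> e) (int m)"
proof -
  have "\<forall>e. \<exists>r'. coprime e m \<longrightarrow>
      (\<forall>u::nat. [int (e * u) = r] (mod int m) \<longleftrightarrow> [int u = r'] (mod int m)) \<and>
      (coprime r (int m) \<longrightarrow> coprime r' (int m))"
    by (metis residue_class_divide)
  from choice[OF this] that show ?thesis by blast
qed

text \<open>Each \<open>(q, q')\<close> counts with multiplicity \<open>d = gcd q q'\<close> if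
  \<open>d\<close> divides \<open>D\<close>. Writing the pair as \<open>d\<close> times a coprime
  pair shrinks the box by \<open>d\<close> in both directions, so the multiplicity \<open>d\<close>
  against \<open>1 / d\<^sup>2\<close> leaves \<open>1 / d\<close>.\<close>

lemma solution_triples_density:
  assumes R: "region_area R A" and m: "m > 0" and r: "coprime r (int m)" and s: "coprime s (int m)"
    and D: "D > 0"
  shows "has_density (\<lambda>X Y. real (card (solution_triples R m r s D X Y)))
           (A * euler_factor m / (real m)\<^sup>2 * (\<Sum>d | d dvd D \<and> coprime d m. 1 / real d))"
proof -
  obtain \<rho> where rho: "\<And>e u::nat. coprime e m \<Longrightarrow> [int (e * u) = r] (mod int m) \<longleftrightarrow> [int u = \<rho> e] (mod int m)"
    using residue_quotients[of m r] by metis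
  obtain \<sigma> where sigma: "\<And>e u::nat. coprime e m \<Longrightarrow> [int (e * u) = s] (mod int m) \<longleftrightarrow> [int u = \<sigma> e] (mod int m)"
    and cop: "\<And>e. coprime e m \<Longrightarrow> coprime (\<sigma> e) (int m)"
    using residue_quotients[of m s] s by metis
  define P where "P d X Y = {(u, v) \<in> lattice_points R m (\<rho> d) (\<sigma> d) (X / real d) (Y / real d). coprime u v}" for d X Y
  have eq: "(\<Sum>d | d dvd D \<and> coprime d m. real d * real (card (P d X Y))) = real (card (solution_triples R m r s D X Y))"
    if XY: "X \<ge> 1" "Y \<ge> 1" for X Y
  proof -
    have fin: "finite (lattice_points R m r s X Y)"
      using finite_lattice_points R XY by (auto simp: region_area_def)
    have "card (solution_triples R m r s D X Y) =
        (\<Sum>(q, q')\<in>lattice_points R m r s X Y. card {a. 0 < a \<and> a \<le> q \<and> q dvd D + a * q'})"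
      unfolding solution_triples_def using fin by (subst card_SigmaI) (auto simp: case_prod_unfold)
    also have "\<dots> = (\<Sum>(q, q')\<in>lattice_points R m r s X Y. if gcd q q' dvd D then gcd q q' else 0)"
      by (intro sum.cong) (auto simp: lattice_points_def card_linear_congruence)
    also have "\<dots> = (\<Sum>x | x \<in> lattice_points R m r s X Y \<and> gcd (fst x) (snd x) dvd D. gcd (fst x) (snd x))"
      using fin by (subst sum.inter_filter) (auto simp: case_prod_unfold)
    also have "\<dots> = (\<Sum>d | d dvd D \<and> coprime d m. \<Sum>x | x \<in> {x \<in> lattice_points R m r s X Y. gcd (fst x) (snd x) dvd D} \<and> gcd (fst x) (snd x) = d. gcd (fst x) (snd x))"
    proof (rule sum.group[symmetric])
      show "(\<lambda>x. gcd (fst x) (snd x)) ` {x \<in> lattice_points R m r s X Y. gcd (fst x) (snd x) dvd D}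
          \<subseteq> {d. d dvd D \<and> coprime d m}"
      proof clarsimp
        fix u v assume uv: "(u, v) \<in> lattice_points R m r s X Y"
        obtain w where w: "u = gcd u v * w" by (metis dvdE gcd_dvd1)
        have "[int (gcd u v * w) = r] (mod int m)" using uv w by (simp add: lattice_points_def)
        then show "coprime (gcd u v) m" using not_cong_if_not_coprime[OF r] by blast
      qed
    qed (use fin D in auto)
    also have "\<dots> = (\<Sum>d | d dvd D \<and> coprime d m. d * card (P d X Y))"
    proof (rule sum.cong)
      fix d assume "d \<in> {d. d dvd D \<and> coprime d m}"
      then have d: "d dvd D" "coprime d m" "d > 0" using D by (auto intro!: Nat.gr0I)
      have "bij_betw (\<lambda>(u, v). (d * u, d * v)) (P d X Y)
          {x. x \<in> {x \<in> lattice_points R m r s X Y. gcd (fst x) (snd x) dvd D} \<and> gcd (fst x) (snd x) = d}"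
        (is "bij_betw ?f _ ?B")
      proof (rule bij_betw_imageI)
        show "inj_on ?f (P d X Y)" using d by (auto simp: inj_on_def)
        show "?f ` P d X Y = ?B"
        proof (intro equalityI subsetI)
          fix x assume "x \<in> ?f ` P d X Y"
          then show "x \<in> ?B"
            using d lattice_points_scale[OF d(3) d(3) rho[OF d(2)] sigma[OF d(2)], of _ _ R X Y]
            by (auto simp: P_def gcd_mult_distrib_nat[symmetric])
        next
          fix x assume x: "x \<in> ?B"
          obtain u v where uv: "x = (u, v)" by force
          then have g: "gcd u v = d" using x by simp
          then obtain u' v' where u': "u = d * u'" "v = d * v'" by (metis dvdE gcd_dvd1 gcd_dvd2)
          then have "d * gcd u' v' = d" using g by (simp add: gcd_mult_distrib_nat)
          then have "coprime u' v'" using d by (metis coprime_iff_gcd_eq_1 mult_cancel1 mult.right_neutral less_irrefl)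
          then have "(u', v') \<in> P d X Y"
            using x uv u' lattice_points_scale[OF d(3) d(3) rho[OF d(2)] sigma[OF d(2)], of u' v' R X Y]
            by (auto simp: P_def)
          then show "x \<in> ?f ` P d X Y" using uv u' by (auto intro!: rev_image_eqI[of "(u', v')"])
        qed
      qed
      from bij_betw_same_card[OF this]
      show "(\<Sum>x | x \<in> {x \<in> lattice_points R m r s X Y. gcd (fst x) (snd x) dvd D} \<and> gcd (fst x) (snd x) = d. gcd (fst x) (snd x))
          = d * card (P d X Y)" by simp
    qed simp
    finally show ?thesis by simp
  qed
  have "has_density (\<lambda>X Y. \<Sum>d | d dvd D \<and> coprime d m. real d * real (card (P d X Y)))
     (\<Sum>d | d dvd D \<and> coprime d m. real d * (A * euler_factor m / (real m)\<^sup>2 / (real d * real d)))"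
  proof (intro has_density_sum has_density_cmult)
    fix d assume "d \<in> {d. d dvd D \<and> coprime d m}"
    then have d: "coprime d m" "d > 0" using D by (auto intro!: Nat.gr0I)
    show "has_density (\<lambda>X Y. real (card (P d X Y))) (A * euler_factor m / (real m)\<^sup>2 / (real d * real d))"
      unfolding P_def by (rule has_density_scale[OF coprime_density[OF R m cop]]) (use d in auto)
  qed
  from has_density_cong[OF this eq]
  have "has_density (\<lambda>X Y. real (card (solution_triples R m r s D X Y)))
     (\<Sum>d | d dvd D \<and> coprime d m. real d * (A * euler_factor m / (real m)\<^sup>2 / (real d * real d)))" by blast
  also have "(\<Sum>d | d dvd D \<and> coprime d m. real d * (A * euler_factor m / (real m)\<^sup>2 / (real d * real d))) =
      A * euler_factor m / (real m)\<^sup>2 * (\<Sum>d | d dvd D \<and> coprime d m. 1 / real d)"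
    unfolding sum_distrib_left by (intro sum.cong) auto
  finally show ?thesis .
qed

text \<open>With \<open>e = gcd a q\<close> and \<open>f = gcd a' q'\<close>, the determinant of the
  unreduced pair is \<open>e * f\<close> times that of the reduced one, while \<open>q\<close> loses
  the factor \<open>e\<close> and \<open>q'\<close> the factor \<open>f\<close>. The region
  \<open>R\<close> is unchanged because the box shrinks along with the denominators.\<close>

lemma solution_triples_by_content:
  assumes R: "R \<subseteq> {0..1} \<times> {0..1}" and r: "coprime r (int m)" and s: "coprime s (int m)"
    and D: "D > 0"
    and rho: "\<And>e u::nat. coprime e m \<Longrightarrow> [int (e * u) = r] (mod int m) \<longleftrightarrow> [int u = \<rho> e] (mod int m)"
    and sigma: "\<And>e u::nat. coprime e m \<Longrightarrow> [int (e * u) = s] (mod int m) \<longleftrightarrow> [int u = \<sigma> e] (mod int m)"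
    and XY: "X > 0" "Y > 0"
  shows "card (solution_triples R m r s D X Y) = (\<Sum>(e, f)\<in>coprime_divisor_pairs m D.
     card (farey_triples R m (\<rho> e) (\<sigma> f) (D div (e * f)) (X / real e) (Y / real f)))"
proof -
  define S where "S = solution_triples R m r s D X Y"
  define k where "k = (\<lambda>((q, q'), a). (gcd a q, gcd ((D + a * q') div q) q'))"
  have "card S = (\<Sum>i\<in>coprime_divisor_pairs m D. card {x\<in>S. k x = i})"
  proof (rule card_group)
    show "finite S" unfolding S_def using finite_solution_triples[OF R XY] .
    show "finite (coprime_divisor_pairs m D)" using finite_coprime_divisor_pairs[OF D] .
    show "k ` S \<subseteq> coprime_divisor_pairs m D"
    proof
      fix i assume "i \<in> k ` S"
      then obtain q q' a where t: "((q, q'), a) \<in> S" and i: "i = k ((q, q'), a)" by auto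
      define b where "b = (D + a * q') div q"
      have lat: "(q, q') \<in> lattice_points R m r s X Y" and dv: "q dvd D + a * q'"
        using t by (auto simp: S_def solution_triples_def)
      have det: "D + a * q' = b * q" using dv by (simp add: b_def)
      \<comment> \<open>The two gcds divide one factor each of \<open>a * q'\<close>, and likewise
        of \<open>b * q\<close>, so their product divides the difference \<open>D\<close>.\<close>
      have "gcd a q * gcd b q' dvd a * q'" by (intro mult_dvd_mono) auto
      moreover have "gcd a q * gcd b q' dvd b * q"
        unfolding mult.commute[of b] by (intro mult_dvd_mono) auto
      ultimately have 1: "gcd a q * gcd b q' dvd D" by (metis det dvd_add_left_iff)
      obtain w where w: "q = gcd a q * w" by (metis dvdE gcd_dvd2)
      have "[int (gcd a q * w) = r] (mod int m)" using lat w by (simp add: lattice_points_def)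
      then have 2: "coprime (gcd a q) m" using not_cong_if_not_coprime[OF r] by blast
      obtain w' where w': "q' = gcd b q' * w'" by (metis dvdE gcd_dvd2)
      have "[int (gcd b q' * w') = s] (mod int m)" using lat w' by (simp add: lattice_points_def)
      then have 3: "coprime (gcd b q') m" using not_cong_if_not_coprime[OF s] by blast
      show "i \<in> coprime_divisor_pairs m D"
        using 1 2 3 unfolding i k_def coprime_divisor_pairs_def b_def by simp
    qed
  qed
  also have "\<dots> = (\<Sum>(e, f)\<in>coprime_divisor_pairs m D.
     card (farey_triples R m (\<rho> e) (\<sigma> f) (D div (e * f)) (X / real e) (Y / real f)))"
  proof (rule sum.cong)
    fix i assume i: "i \<in> coprime_divisor_pairs m D"
    obtain e f where ef: "i = (e, f)" by force
    with i have efm: "coprime e m" "coprime f m" and "e * f dvd D" by (auto simp: coprime_divisor_pairs_def)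
    then obtain n where n: "D = e * f * n" by (auto elim: dvdE)
    have pos: "e > 0" "f > 0" "n > 0" using n D by auto
    have Dn: "D div (e * f) = n" using pos n by simp
    note scale = lattice_points_scale[OF pos(1,2) rho[OF efm(1)] sigma[OF efm(2)], of _ _ R X Y]
    define T where "T = farey_triples R m (\<rho> e) (\<sigma> f) n (X / real e) (Y / real f)"
    let ?g = "\<lambda>((q, q'), a). ((e * q, f * q'), e * a)"
    have "bij_betw ?g T {x\<in>S. k x = i}"
    proof (rule bij_betw_imageI)
      show "inj_on ?g T" using pos by (auto simp: inj_on_def)
      show "?g ` T = {x\<in>S. k x = i}"
      proof (intro equalityI subsetI)
        fix x assume "x \<in> ?g ` T"
        then obtain q q' a where x: "x = ((e * q, f * q'), e * a)" and t: "((q, q'), a) \<in> T" by auto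
        have lat: "(q, q') \<in> lattice_points R m (\<rho> e) (\<sigma> f) (X / real e) (Y / real f)"
          and a: "0 < a" "a \<le> q" "q dvd n + a * q'" "coprime a q" "coprime ((n + a * q') div q) q'"
          using t by (auto simp: T_def farey_triples_def solution_triples_def)
        define b where "b = (n + a * q') div q"
        have b: "n + a * q' = b * q" using a(3) by (simp add: b_def)
        have q: "q > 0" using a by simp
        have eq: "D + (e * a) * (f * q') = f * b * (e * q)"
          using arg_cong[OF b, of "\<lambda>z. e * f * z"] by (simp add: n algebra_simps)
        have bb: "(D + (e * a) * (f * q')) div (e * q) = f * b" unfolding eq using q pos by simp
        have "x \<in> S"
          using lat a pos unfolding S_def x solution_triples_def by (simp add: scale eq)
        moreover have "k x = (e, f)"
          unfolding x k_def prod.case bb using a(4,5)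
          by (simp add: gcd_mult_distrib_nat[symmetric] b_def)
        ultimately show "x \<in> {x\<in>S. k x = i}" using ef by simp
      next
        fix x assume x: "x \<in> {x\<in>S. k x = i}"
        obtain Q Q' a where xe: "x = ((Q, Q'), a)" by (metis prod.exhaust)
        define b where "b = (D + a * Q') div Q"
        have lat: "(Q, Q') \<in> lattice_points R m r s X Y" and a: "0 < a" "a \<le> Q" "Q dvd D + a * Q'"
          using x xe by (auto simp: S_def solution_triples_def)
        have g: "gcd a Q = e" "gcd b Q' = f" using x xe ef by (auto simp: k_def b_def)
        have b: "D + a * Q' = b * Q" using a(3) by (simp add: b_def)
        obtain a1 q where a1: "a = e * a1" "Q = e * q" using g(1) by (metis dvdE gcd_dvd1 gcd_dvd2)
        obtain b1 q' where b1: "b = f * b1" "Q' = f * q'" using g(2) by (metis dvdE gcd_dvd1 gcd_dvd2)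
        have "e * gcd a1 q = e * 1" using g(1) a1 by (simp add: gcd_mult_distrib_nat)
        then have c1: "coprime a1 q" using pos by (metis coprime_iff_gcd_eq_1 mult_left_cancel less_irrefl)
        have "f * gcd b1 q' = f * 1" using g(2) b1 by (simp add: gcd_mult_distrib_nat)
        then have c2: "coprime b1 q'" using pos by (metis coprime_iff_gcd_eq_1 mult_left_cancel less_irrefl)
        have "e * f * (n + a1 * q') = e * f * (b1 * q)"
          using b unfolding a1 b1 n by (simp add: algebra_simps)
        then have det: "n + a1 * q' = b1 * q" using pos by simp
        have q: "q > 0" "0 < a1" "a1 \<le> q" using a a1 pos by auto
        have "((q, q'), a1) \<in> T"
          using lat c1 c2 q unfolding T_def farey_triples_def solution_triples_def
          by (simp add: scale[symmetric] a1[symmetric] b1[symmetric] det)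
        then show "x \<in> ?g ` T" using xe a1 b1 by (auto intro!: rev_image_eqI[of "((q, q'), a1)"])
      qed
    qed
    from bij_betw_same_card[OF this]
    show "card {x\<in>S. k x = i} = (case i of (e, f) \<Rightarrow>
        card (farey_triples R m (\<rho> e) (\<sigma> f) (D div (e * f)) (X / real e) (Y / real f)))"
      by (simp add: ef T_def Dn)
  qed simp
  finally show ?thesis unfolding S_def .
qed

text \<open>In the sum over contents the pair \<open>(1, 1)\<close> gives the wanted count. All
  other terms have a smaller determinant, in other unit classes and a smaller box, and are known by
  induction; \<open>sum_delta_density\<close> evaluates what remains after subtracting them.\<close>

lemma farey_triples_density:
  assumes R: "region_area R A" and m: "m > 0" and "coprime r (int m)" and "coprime s (int m)"
    and "D > 0"
  shows "has_density (\<lambda>X Y. real (card (farey_triples R m r s D X Y)))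
           (A * euler_factor m / (real m)\<^sup>2 * delta_density m D)"
  using assms(3-5)
proof (induction D arbitrary: r s rule: less_induct)
  case (less D)
  define c where "c = A * euler_factor m / (real m)\<^sup>2"
  define I where "I = coprime_divisor_pairs m D"
  obtain \<rho> where rho: "\<And>e u::nat. coprime e m \<Longrightarrow> [int (e * u) = r] (mod int m) \<longleftrightarrow> [int u = \<rho> e] (mod int m)"
    and crho: "\<And>e. coprime e m \<Longrightarrow> coprime (\<rho> e) (int m)"
    using residue_quotients[of m r] less.prems(1) by metis
  obtain \<sigma> where sigma: "\<And>e u::nat. coprime e m \<Longrightarrow> [int (e * u) = s] (mod int m) \<longleftrightarrow> [int u = \<sigma> e] (mod int m)"
    and csigma: "\<And>e. coprime e m \<Longrightarrow> coprime (\<sigma> e) (int m)"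
    using residue_quotients[of m s] less.prems(2) by metis
  define T where "T i X Y = (case i of (e, f) \<Rightarrow>
    real (card (farey_triples R m (\<rho> e) (\<sigma> f) (D div (e * f)) (X / real e) (Y / real f))))" for i X Y
  define t where "t i = (case i of (e, f) \<Rightarrow> delta_density m (D div (e * f)) / (real e * real f))" for i
  have finI: "finite I" unfolding I_def by (rule finite_coprime_divisor_pairs[OF less.prems(3)])
  have 1: "(1, 1) \<in> I" by (simp add: I_def coprime_divisor_pairs_def)
  have T1: "T (1, 1) X Y = real (card (farey_triples R m r s D X Y))" for X Y
  proof -
    \<comment> \<open>\<open>\<rho> 1\<close> need not equal \<open>r\<close>, but it is the same
      class modulo \<open>m\<close>.\<close>
    have "lattice_points R m (\<rho> 1) (\<sigma> 1) X Y = lattice_points R m r s X Y"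
      using rho[of 1] sigma[of 1] by (simp add: lattice_points_def)
    then show ?thesis by (simp add: T_def farey_triples_def solution_triples_def)
  qed
  have dens: "has_density (T i) (c * t i)" if "i \<in> I - {(1, 1)}" for i
  proof -
    obtain e f where ef: "i = (e, f)" by force
    have efm: "coprime e m" "coprime f m" "e * f dvd D" "(e, f) \<noteq> (1, 1)"
      using that ef by (auto simp: I_def coprime_divisor_pairs_def)
    obtain n where n: "D = e * f * n" using efm(3) by (auto elim: dvdE)
    have pos: "e > 0" "f > 0" "n > 0" using n less.prems(3) by auto
    then have Dn: "D div (e * f) = n" using n by simp
    have "e * f \<noteq> 1" using efm(4) by simp
    then have "e * f > 1" using pos by (metis One_nat_def Suc_lessI nat_0_less_mult_iff)
    then have "n < D" using pos n by simp
    from has_density_scale[OF less.IH[OF this crho[OF efm(1)] csigma[OF efm(2)] pos(3)], of "real e" "real f"]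
    show ?thesis using pos unfolding ef T_def t_def prod.case Dn c_def by simp
  qed
  have all: "has_density (\<lambda>X Y. real (card (solution_triples R m r s D X Y))) (c * (\<Sum>i\<in>I. t i))"
    using solution_triples_density[OF R m less.prems]
    unfolding I_def t_def sum_delta_density[OF less.prems(3) m] c_def .
  have "has_density (\<lambda>X Y. real (card (solution_triples R m r s D X Y)) - (\<Sum>i\<in>I - {(1, 1)}. T i X Y))
      (c * (\<Sum>i\<in>I. t i) - (\<Sum>i\<in>I - {(1, 1)}. c * t i))"
    by (intro has_density_diff all has_density_sum dens)
  moreover have "c * (\<Sum>i\<in>I. t i) - (\<Sum>i\<in>I - {(1, 1)}. c * t i) = c * delta_density m D"
    unfolding sum_distrib_left[symmetric] sum.remove[OF finI 1] by (simp add: t_def algebra_simps)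
  moreover have "real (card (solution_triples R m r s D X Y)) - (\<Sum>i\<in>I - {(1, 1)}. T i X Y) =
      real (card (farey_triples R m r s D X Y))" if XY: "X \<ge> 1" "Y \<ge> 1" for X Y
  proof -
    have "real (card (solution_triples R m r s D X Y)) = (\<Sum>i\<in>I. T i X Y)"
      unfolding I_def T_def
      by (subst solution_triples_by_content[OF _ less.prems rho sigma])
        (use R XY in \<open>auto simp: region_area_def case_prod_unfold\<close>)
    also have "\<dots> = real (card (farey_triples R m r s D X Y)) + (\<Sum>i\<in>I - {(1, 1)}. T i X Y)"
      unfolding sum.remove[OF finI 1] T1 ..
    finally show ?thesis by simp
  qed
  ultimately show ?case using has_density_cong[of _ _ 1 1] unfolding c_def by (metis (no_types, lifting))
qed

subsection \<open>The number of fractions\<close>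

lemma reduced_fraction_unique:
  fixes a q a' q' :: nat
  assumes "coprime a q" "coprime a' q'" "q > 0" "q' > 0" "real a / real q = real a' / real q'"
  shows "a = a' \<and> q = q'"
proof -
  have "real (a * q') = real (a' * q)" using assms by (simp add: field_simps)
  then have "a * q' = a' * q" by linarith
  then show ?thesis using coprime_crossproduct_nat[of a q a' q'] assms(1,2) by (simp add: coprime_commute)
qed

lemma farey_cong_altdef:
  "farey_cong m b Q = (\<lambda>(a, q). real a / real q) `
     {(a, q). 0 < a \<and> a \<le> q \<and> q \<le> Q \<and> coprime a q \<and> [int q = b] (mod int m)}"
  by (auto simp: farey_cong_def)

lemma farey_congI:
  assumes "0 < a" "a \<le> q" "q \<le> Q" "coprime a q" "[int q = b] (mod int m)"
  shows "real a / real q \<in> farey_cong m b Q"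
  using assms by (auto simp: farey_cong_def)

lemma finite_farey_pairs:
  "finite {(a::nat, q). 0 < a \<and> a \<le> q \<and> q \<le> Q \<and> coprime a q \<and> [int q = b] (mod int m)}"
  by (rule finite_subset[of _ "{..Q} \<times> {..Q}"]) auto

lemma card_farey_cong:
  "card (farey_cong m b Q) =
     card {(a::nat, q). 0 < a \<and> a \<le> q \<and> q \<le> Q \<and> coprime a q \<and> [int q = b] (mod int m)}"
  unfolding farey_cong_altdef
  by (rule card_image) (auto simp: inj_on_def dest: reduced_fraction_unique)

text \<open>Numerators carry no congruence, whereas lattice points are counted in a class for each
  coordinate, so the count is summed over the \<open>m\<close> classes of \<open>a\<close>:
  \<open>m\<close> times \<open>1 / 2 * euler_factor m / m\<^sup>2\<close>.\<close>

lemma card_farey_cong_asymp: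
  assumes m: "m > 0" and b: "coprime b (int m)"
  shows "(\<lambda>Q. real (card (farey_cong m b Q)) / (real Q)\<^sup>2) \<longlonglongrightarrow> euler_factor m / (2 * real m)"
proof -
  define R where "R = {(x::real, y). 0 \<le> x \<and> x \<le> y \<and> y \<le> 1}"
  define P where "P r X Y = {(u, v) \<in> lattice_points R m (int r) b X Y. coprime u v}" for r X Y
  have "has_density (\<lambda>X Y. \<Sum>r<m. real (card (P r X Y))) (\<Sum>r<m. 1 / 2 * euler_factor m / (real m)\<^sup>2)"
    unfolding P_def R_def by (intro has_density_sum coprime_density region_area_triangle m b)
  from has_density_diagonal[OF this]
  have lim: "(\<lambda>Q. (\<Sum>r<m. real (card (P r (real Q) (real Q)))) / (real Q)\<^sup>2) \<longlonglongrightarrow> euler_factor m / (2 * real m)"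
    using m by (simp add: power2_eq_square)
  have "(\<Sum>r<m. real (card (P r (real Q) (real Q)))) = real (card (farey_cong m b Q))" if Q: "Q > 0" for Q
  proof -
    define B where "B = {(a::nat, q). 0 < a \<and> a \<le> q \<and> q \<le> Q \<and> coprime a q \<and> [int q = b] (mod int m)}"
    have "card B = (\<Sum>r\<in>{..<m}. card {x\<in>B. fst x mod m = r})"
      by (rule card_group) (use m finite_farey_pairs in \<open>auto simp: B_def\<close>)
    also have "\<dots> = (\<Sum>r<m. card (P r (real Q) (real Q)))"
    proof (rule sum.cong)
      fix r assume "r \<in> {..<m}"
      then have "{x\<in>B. fst x mod m = r} = P r (real Q) (real Q)"
        using Q by (auto simp: B_def P_def lattice_points_def R_def divide_right_mono cong_int_iff
              divide_le_cancel cong_def[of _ r m])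
      then show "card {x\<in>B. fst x mod m = r} = card (P r (real Q) (real Q))" by simp
    qed simp
    finally show ?thesis unfolding card_farey_cong B_def[symmetric] by simp
  qed
  then have "eventually (\<lambda>Q. (\<Sum>r<m. real (card (P r (real Q) (real Q)))) / (real Q)\<^sup>2 =
      real (card (farey_cong m b Q)) / (real Q)\<^sup>2) sequentially"
    by (intro eventually_sequentiallyI[of 1]) auto
  from Lim_transform_eventually[OF lim this] show ?thesis .
qed

subsection \<open>Counting close pairs by their determinant\<close>

text \<open>Origin of the hyperbola: a difference \<open>D / (q * q')\<close> of at most
  \<open>l / N\<close> means \<open>q * q' \<ge> N * D / l\<close>, and dividing by
  \<open>Q\<^sup>2\<close> puts this into the unit square.\<close>

lemma mem_farey_triples_hyperbola:
  assumes "Q > 0" "l > 0" "N > 0"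
  shows "((q, q'), a) \<in> farey_triples (hyperbola_region (N * real D / (l * (real Q)\<^sup>2))) m b b D (real Q) (real Q) \<longleftrightarrow>
    0 < q' \<and> q \<le> Q \<and> q' \<le> Q \<and> [int q = b] (mod int m) \<and> [int q' = b] (mod int m) \<and>
    real D / (real q * real q') \<le> l / N \<and>
    0 < a \<and> a \<le> q \<and> coprime a q \<and> q dvd D + a * q' \<and> coprime ((D + a * q') div q) q'"
proof -
  have "N * real D / (l * (real Q)\<^sup>2) \<le> real q / real Q * (real q' / real Q) \<longleftrightarrow> real D / (real q * real q') \<le> l / N"
    if "0 < q" "0 < q'"
  proof -
    have "N * real D / (l * (real Q)\<^sup>2) \<le> real q / real Q * (real q' / real Q) \<longleftrightarrow>
        (N * real D / l) / (real Q)\<^sup>2 \<le> (real q * real q') / (real Q)\<^sup>2"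
      by (simp add: power2_eq_square)
    also have "\<dots> \<longleftrightarrow> N * real D / l \<le> real q * real q'" unfolding divide_le_cancel using assms(1) by simp
    also have "\<dots> \<longleftrightarrow> real D / (real q * real q') \<le> l / N" using assms that by (simp add: field_simps)
    finally show ?thesis .
  qed
  then show ?thesis
    using assms(1) by (auto simp: farey_triples_def solution_triples_def lattice_points_def hyperbola_region_def)
qed

text \<open>A close pair is recovered from its first fraction and its forward gap
  \<open>D / (q * q')\<close> on the circle. As \<open>N > l\<close>, the gap is less than a full
  turn, so the pair determines it and at most one wrap occurs. \<open>M\<close> bounds
  \<open>D \<le> (l / N) * q * q'\<close>.\<close>

lemma card_close_pairs:
  assumes Q: "Q > 0" and l: "l > 0" and N: "N > l"
    and M: "l * (real Q)\<^sup>2 / N \<le> real M"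
  shows "card {(x, y). x \<in> farey_cong m b Q \<and> y \<in> farey_cong m b Q \<and> y \<noteq> x \<and>
                (\<exists>t\<in>{0..l}. \<exists>k::int. y - x = t / N + of_int k)} =
     (\<Sum>D=1..M. card (farey_triples (hyperbola_region (N * real D / (l * (real Q)\<^sup>2))) m b b D (real Q) (real Q)))"
    (is "card ?P = (\<Sum>D=1..M. card (?T D))")
proof -
  have N0: "N > 0" using l N by simp
  have lN: "l / N < 1" using N N0 by simp
  \<comment> \<open>The second fraction before folding; \<open>g\<close> subtracts 1 when it has
    passed 1.\<close>
  define Z where "Z = (\<lambda>(D::nat, (q::nat, q'::nat), a::nat). real a / real q + real D / (real q * real q'))"
  define g where "g = (\<lambda>x. (case x of (D::nat, (q::nat, q'::nat), a::nat) \<Rightarrow> real a / real q, if Z x \<le> 1 then Z x else Z x - 1))"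
  note mem = mem_farey_triples_hyperbola[OF Q l N0]
  have Zeq: "Z (D, (q, q'), a) = real ((D + a * q') div q) / real q'" if "((q, q'), a) \<in> ?T D" for D q q' a
  proof -
    have h: "0 < q" "0 < q'" "q dvd D + a * q'" using that by (auto simp: mem)
    have "real ((D + a * q') div q) * real q = real (D + a * q')" using h by (metis dvd_div_mult_self of_nat_mult)
    then show ?thesis using h unfolding Z_def by (simp add: field_simps)
  qed
  have "bij_betw g (Sigma {1..M} ?T) ?P"
  proof (rule bij_betw_imageI)
    show "inj_on g (Sigma {1..M} ?T)"
    proof (rule inj_onI)
      fix t1 t2 assume t: "t1 \<in> Sigma {1..M} ?T" "t2 \<in> Sigma {1..M} ?T" "g t1 = g t2"
      obtain D1 q1 q1' a1 where t1: "t1 = (D1, (q1, q1'), a1)" by (metis prod.exhaust)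
      obtain D2 q2 q2' a2 where t2: "t2 = (D2, (q2, q2'), a2)" by (metis prod.exhaust)
      have T1: "((q1, q1'), a1) \<in> ?T D1" "D1 > 0" and T2: "((q2, q2'), a2) \<in> ?T D2" "D2 > 0"
        using t(1,2) t1 t2 by auto
      note m1 = T1(1)[unfolded mem] and m2 = T2(1)[unfolded mem]
      have x: "real a1 / real q1 = real a2 / real q2" using t(3) by (simp add: g_def t1 t2)
      then have aq: "a1 = a2" "q1 = q2" using reduced_fraction_unique[of a1 q1 a2 q2] m1 m2 by auto
      have "real D1 / (real q1 * real q1') \<le> l / N" using m1 by blast
      from le_less_trans[OF this lN] have d1: "0 < real D1 / (real q1 * real q1')" "real D1 / (real q1 * real q1') < 1"
        using m1 T1(2) by simp_all
      have "real D2 / (real q2 * real q2') \<le> l / N" using m2 by blast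
      from le_less_trans[OF this lN] have d2: "0 < real D2 / (real q2 * real q2')" "real D2 / (real q2 * real q2') < 1"
        using m2 T2(2) by simp_all
      have "(if Z t1 \<le> 1 then Z t1 else Z t1 - 1) = (if Z t2 \<le> 1 then Z t2 else Z t2 - 1)"
        using t(3) by (simp add: g_def)
      \<comment> \<open>Unfolded values with equal folding differ by an integer, and both lie
        strictly between \<open>x\<close> and \<open>x + 1\<close> for the common first fraction
        \<open>x\<close>.\<close>
      then have Z12: "Z t1 = Z t2" using d1 d2 x unfolding t1 t2 Z_def by (auto split: if_splits)
      then have "real ((D1 + a1 * q1') div q1) / real q1' = real ((D2 + a2 * q2') div q2) / real q2'"
        using Zeq T1 T2 t1 t2 by simp
      then have q': "q1' = q2'" using m1 m2 reduced_fraction_unique by blast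
      have "real D1 / (real q1 * real q1') = real D2 / (real q2 * real q2')"
        using Z12 x unfolding t1 t2 Z_def by simp
      then have "D1 = D2" using aq q' m1 by simp
      then show "t1 = t2" using t1 t2 aq q' by simp
    qed
    show "g ` Sigma {1..M} ?T = ?P"
    proof (intro equalityI subsetI)
      fix p assume "p \<in> g ` Sigma {1..M} ?T"
      then obtain D q q' a where p: "p = g (D, (q, q'), a)" and D: "D > 0" and T: "((q, q'), a) \<in> ?T D" by auto
      note mm = T[unfolded mem]
      define B where "B = (D + a * q') div q"
      define z where "z = Z (D, (q, q'), a)"
      have z: "z = real B / real q'" unfolding z_def B_def by (rule Zeq[OF T])
      define x where "x = real a / real q"
      have zx: "z = x + real D / (real q * real q')" by (simp add: z_def Z_def x_def)
      have d: "0 < real D / (real q * real q')" "real D / (real q * real q') \<le> l / N" using mm D by simp_all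
      have x01: "0 < x" "x \<le> 1" using mm by (auto simp: x_def)
      have xF: "x \<in> farey_cong m b Q" unfolding x_def by (rule farey_congI) (use mm in simp_all)
      define y where "y = (if z \<le> 1 then z else z - 1)"
      have py: "p = (x, y)" by (simp add: p g_def x_def y_def z_def)
      have tN: "N * (real D / (real q * real q')) \<in> {0..l}" "N * (real D / (real q * real q')) / N = z - x"
        using d N0 zx by (auto simp: field_simps)
      have cB: "coprime B q'" using mm B_def by simp
      have q'0: "q' > 0" using mm by simp
      have yF: "y \<in> farey_cong m b Q"
      proof (cases "z \<le> 1")
        case True
        have "z > 0" using zx x01 d by linarith
        then have "0 < B" using z by (auto intro!: Nat.gr0I)
        moreover have "B \<le> q'" using True z q'0 by simp
        ultimately
        show ?thesis using farey_congI[of B q' Q b m] True mm cB z by (simp add: y_def)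
      next
        case False
        have "z < 2" using zx x01 d lN by linarith
        then have B: "q' < B" "B < 2 * q'" using False z q'0 by (auto simp: field_simps)
        then have "z - 1 = real (B - q') / real q'" using z q'0 by (simp add: field_simps)
        moreover have "coprime (B - q') q'" using cB B by (metis coprime_iff_gcd_eq_1 gcd_diff1_nat less_imp_le)
        ultimately have "z - 1 \<in> farey_cong m b Q" using farey_congI[of "B - q'" q' Q b m] mm B by simp
        then show ?thesis using False by (simp add: y_def)
      qed
      have "\<exists>t\<in>{0..l}. \<exists>k::int. y - x = t / N + of_int k"
        by (rule bexI[OF _ tN(1)], rule exI[of _ "if z \<le> 1 then 0 else -1"]) (use tN(2) in \<open>simp add: y_def\<close>)
      moreover have "z \<noteq> x" "z - 1 \<noteq> x" using zx d lN by linarith+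
      then have "y \<noteq> x" by (simp add: y_def)
      ultimately show "p \<in> ?P" using py xF yF by simp
    next
      fix p assume "p \<in> ?P"
      then obtain x y t k where p: "p = (x, y)" and xF: "x \<in> farey_cong m b Q" and yF: "y \<in> farey_cong m b Q"
        and "y \<noteq> x" and t: "0 \<le> t" "t \<le> l" and k: "y - x = t / N + of_int k" by auto
      obtain a q where a: "x = real a / real q" "0 < a" "a \<le> q" "q \<le> Q" "coprime a q" "[int q = b] (mod int m)"
        using xF by (auto simp: farey_cong_def)
      obtain a' q' where a': "y = real a' / real q'" "0 < a'" "a' \<le> q'" "q' \<le> Q" "coprime a' q'" "[int q' = b] (mod int m)"
        using yF by (auto simp: farey_cong_def)
      have q0: "q > 0" "q' > 0" using a a' by auto
      have x01: "0 < x" "x \<le> 1" "0 < y" "y \<le> 1" using a a' by auto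
      have tN: "0 \<le> t / N" "t / N \<le> l / N" "t / N < 1"
        using t N0 N by (auto simp: divide_right_mono)
      have "real_of_int k < 1" "real_of_int k > -2" using k tN x01 by linarith+
      then have k01: "k = 0 \<or> k = -1" by linarith
      \<comment> \<open>The numerator of the unfolded second fraction: \<open>k = -1\<close> is a
        wrap past 1 and adds a full denominator.\<close>
      define B where "B = (if k = 0 then a' else a' + q')"
      define z where "z = real B / real q'"
      have z: "z = y - of_int k" using k01 q0 by (auto simp: z_def B_def a'(1) field_simps)
      have zx: "z - x = t / N" using k z by simp
      have "z > x"
      proof -
        have "z \<noteq> x" using k01 z x01 \<open>y \<noteq> x\<close> by auto
        then show ?thesis using zx tN by linarith
      qed
      then have "real (a * q') < real (B * q)" using q0 by (simp add: z_def a(1) field_simps)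
      then have lt: "a * q' < B * q" by (simp only: of_nat_less_iff)
      define D where "D = B * q - a * q'"
      have D: "D > 0" "D + a * q' = B * q" using lt by (auto simp: D_def)
      have "real D = real B * real q - real a * real q'" using lt by (simp add: D_def of_nat_diff)
      then have Dz: "real D / (real q * real q') = z - x" using q0 by (simp add: z_def a(1) field_simps)
      have "coprime (a' + q') q'" using a'(5) by (simp only: coprime_iff_gcd_eq_1 gcd_add1)
      then have cB: "coprime B q'" using a'(5) by (simp add: B_def)
      have BD: "(D + a * q') div q = B" using D q0 by simp
      have T: "((q, q'), a) \<in> ?T D"
        unfolding mem BD using a a' q0 cB D(2) Dz zx tN by auto
      have "D \<le> M"
      proof -
        have "real D / (real q * real q') \<le> l / N" using Dz zx tN(2) by simp
        then have "real D \<le> l / N * (real q * real q')" using q0 by (simp add: pos_divide_le_eq)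
        also have "\<dots> \<le> l / N * (real Q * real Q)"
          using a a' l N0 by (intro mult_left_mono mult_mono) auto
        also have "\<dots> \<le> real M" using M by (simp add: power2_eq_square)
        finally show ?thesis by simp
      qed
      have Zz: "Z (D, (q, q'), a) = z" using Zeq[OF T] BD by (simp add: z_def)
      have "(if z \<le> 1 then z else z - 1) = y" using k01 z x01 by auto
      then have "p = g (D, (q, q'), a)" using p a(1) Zz by (auto simp: g_def)
      moreover have "(D, (q, q'), a) \<in> Sigma {1..M} ?T" using T D(1) \<open>D \<le> M\<close> by auto
      ultimately show "p \<in> g ` Sigma {1..M} ?T" by blast
    qed
  qed
  from bij_betw_same_card[OF this]
  have "card ?P = card (Sigma {1..M} ?T)" by simp
  also have "\<dots> = (\<Sum>D=1..M. card (?T D))"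
  proof (rule card_SigmaI)
    show "\<forall>D\<in>{1..M}. finite (?T D)"
    proof
      fix D
      have "hyperbola_region (N * real D / (l * (real Q)\<^sup>2)) \<subseteq> {0..1} \<times> {0..1}" by (auto simp: hyperbola_region_def)
      from finite_solution_triples[OF this, of "real Q" "real Q" m b b D]
      show "finite (?T D)" by (rule finite_subset[rotated]) (use Q in \<open>auto simp: farey_triples_def\<close>)
    qed
  qed simp
  finally show ?thesis .
qed

subsection \<open>The limit and its density\<close>

lemma isCont_hyperbola_area:
  assumes "k > 0"
  shows "isCont hyperbola_area k"
proof -
  \<comment> \<open>Truncating the argument at 1 merges the two cases, since
    \<open>1 - k + k * ln k\<close> vanishes at \<open>k = 1\<close>.\<close>
  have "hyperbola_area = (\<lambda>k. 1 - min k 1 + min k 1 * ln (min k 1))"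
    by (auto simp: hyperbola_area_def fun_eq_iff min_def)
  moreover have "isCont (\<lambda>k::real. 1 - min k 1 + min k 1 * ln (min k 1)) k"
    using assms by (intro continuous_intros) (auto simp: min_def)
  ultimately show ?thesis by simp
qed

text \<open>Replaces uniform convergence in the parameter: the moving \<open>\<kappa> n\<close> is
  eventually caught between two fixed parameters near \<open>k0\<close>, where the pointwise limits
  apply. It is needed because the hyperbola involves the exact number of fractions.\<close>

lemma LIMSEQ_antimono_parameter:
  fixes f :: "real \<Rightarrow> nat \<Rightarrow> real"
  assumes lim: "\<And>k. k > 0 \<Longrightarrow> f k \<longlonglongrightarrow> L k"
    and anti: "\<And>k k' n. 0 < k \<Longrightarrow> k \<le> k' \<Longrightarrow> f k' n \<le> f k n"
    and \<kappa>: "\<kappa> \<longlonglongrightarrow> k0" "k0 > 0" and cont: "isCont L k0"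
  shows "(\<lambda>n. f (\<kappa> n) n) \<longlonglongrightarrow> L k0"
proof (rule tendstoI)
  fix e :: real assume e: "e > 0"
  obtain d where d: "d > 0" "\<And>k. \<bar>k - k0\<bar> < d \<Longrightarrow> \<bar>L k - L k0\<bar> < e / 2"
    using cont e unfolding continuous_at_real_range by (metis half_gt_zero real_norm_def)
  \<comment> \<open>The first bound gives closeness of \<open>L\<close>, the second keeps
    \<open>k0 - h\<close> positive.\<close>
  define h where "h = min (d / 2) (k0 / 2)"
  have h: "h > 0" "h < d" "k0 - h > 0" using d(1) \<kappa>(2) by (auto simp: h_def min_def)
  have L: "\<bar>L (k0 - h) - L k0\<bar> < e / 2" "\<bar>L (k0 + h) - L k0\<bar> < e / 2" using d(2) h by auto
  have "eventually (\<lambda>n. f (k0 - h) n < L (k0 - h) + e / 2) sequentially"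
    "eventually (\<lambda>n. f (k0 + h) n > L (k0 + h) - e / 2) sequentially"
    "eventually (\<lambda>n. \<kappa> n < k0 + h) sequentially" "eventually (\<lambda>n. \<kappa> n > k0 - h) sequentially"
    using order_tendstoD[OF lim] order_tendstoD[OF \<kappa>(1)] h \<kappa>(2) e by auto
  then show "eventually (\<lambda>n. dist (f (\<kappa> n) n) (L k0) < e) sequentially"
  proof eventually_elim
    case (elim n)
    have "f (\<kappa> n) n \<le> f (k0 - h) n" "f (k0 + h) n \<le> f (\<kappa> n) n" using anti elim h by auto
    then show ?case using elim L unfolding dist_real_def by linarith
  qed
qed

lemma card_farey_triples_antimono:
  assumes "k \<le> k'" "Q > 0"
  shows "card (farey_triples (hyperbola_region k') m r s D (real Q) (real Q)) \<le>
         card (farey_triples (hyperbola_region k) m r s D (real Q) (real Q))"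
proof (rule card_mono)
  have "hyperbola_region k \<subseteq> {0..1} \<times> {0..1}" by (auto simp: hyperbola_region_def)
  from finite_solution_triples[OF this, of "real Q" "real Q" m r s D] assms(2)
  show "finite (farey_triples (hyperbola_region k) m r s D (real Q) (real Q))"
    by (rule_tac finite_subset[rotated]) (auto simp: farey_triples_def)
  show "farey_triples (hyperbola_region k') m r s D (real Q) (real Q) \<subseteq>
      farey_triples (hyperbola_region k) m r s D (real Q) (real Q)"
    using assms(1)
    by (auto simp: farey_triples_def solution_triples_def lattice_points_def hyperbola_region_def)
qed

text \<open>The determinants are at most \<open>l * Q\<^sup>2 / N\<close>, which tends to
  \<open>l / \<nu>\<close>, so a fixed \<open>M\<close> eventually suffices. Numerator and
  denominator of the pair correlation are both scaled by \<open>Q\<^sup>2\<close>; in the quotient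
  \<open>euler_factor m\<close> cancels and \<open>2 / m\<close> remains.\<close>

lemma pair_corr_farey_cong_LIMSEQ:
  assumes m: "m > 0" and b: "coprime b (int m)" and l: "l > 0"
    and M: "l / (euler_factor m / (2 * real m)) < real M"
  shows "(\<lambda>Q. pair_corr (farey_cong m b Q) {0..l}) \<longlonglongrightarrow>
    (\<Sum>D=1..M. 2 / real m * delta_density m D * hyperbola_area (euler_factor m / (2 * real m) * real D / l))"
proof -
  define \<nu> where "\<nu> = euler_factor m / (2 * real m)"
  have nu: "\<nu> > 0" using euler_factor_pos m by (simp add: \<nu>_def)
  define N where "N Q = real (card (farey_cong m b Q))" for Q
  have N: "(\<lambda>Q. N Q / (real Q)\<^sup>2) \<longlonglongrightarrow> \<nu>" unfolding N_def \<nu>_def by (rule card_farey_cong_asymp[OF m b])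
  define f where "f D k Q = real (card (farey_triples (hyperbola_region k) m b b D (real Q) (real Q))) / (real Q)\<^sup>2" for D k Q
  define c where "c D = euler_factor m / (real m)\<^sup>2 * delta_density m D" for D
  have lim: "(\<lambda>Q. f D (N Q / (real Q)\<^sup>2 * real D / l) Q) \<longlonglongrightarrow> hyperbola_area (\<nu> * real D / l) * c D" if D: "D > 0" for D
  proof (rule LIMSEQ_antimono_parameter[where f = "f D" and L = "\<lambda>k. hyperbola_area k * c D"])
    show "f D k \<longlonglongrightarrow> hyperbola_area k * c D" if "k > 0" for k
      using has_density_diagonal[OF farey_triples_density[OF region_area_hyperbola[OF that] m b b D]]
      unfolding f_def c_def by (simp add: mult_ac)
    show "f D k' n \<le> f D k n" if "0 < k" "k \<le> k'" for k k' n
      using card_farey_triples_antimono[OF that(2), of n m b b D]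
      \<comment> \<open>For \<open>n = 0\<close> both sides are 0, being quotients by 0.\<close>
      unfolding f_def by (cases "n = 0") (auto intro!: divide_right_mono)
    show "(\<lambda>Q. N Q / (real Q)\<^sup>2 * real D / l) \<longlonglongrightarrow> \<nu> * real D / l"
      by (intro tendsto_divide tendsto_mult N tendsto_const) (use l in auto)
    show "\<nu> * real D / l > 0" using nu D l by simp
    then show "isCont (\<lambda>k. hyperbola_area k * c D) (\<nu> * real D / l)"
      by (intro continuous_mult_right isCont_hyperbola_area continuous_intros)
  qed
  have "(\<lambda>Q. (\<Sum>D=1..M. f D (N Q / (real Q)\<^sup>2 * real D / l) Q) / (N Q / (real Q)\<^sup>2)) \<longlonglongrightarrow>
      (\<Sum>D=1..M. hyperbola_area (\<nu> * real D / l) * c D) / \<nu>"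
    by (intro tendsto_divide tendsto_sum lim N) (use nu in auto)
  also have "(\<Sum>D=1..M. hyperbola_area (\<nu> * real D / l) * c D) / \<nu> =
      (\<Sum>D=1..M. 2 / real m * delta_density m D * hyperbola_area (\<nu> * real D / l))"
    unfolding sum_divide_distrib
  proof (rule sum.cong)
    fix D
    have "c D / \<nu> = 2 / real m * delta_density m D"
      using euler_factor_pos[of m] m by (simp add: c_def \<nu>_def power2_eq_square)
    then show "hyperbola_area (\<nu> * real D / l) * c D / \<nu> = 2 / real m * delta_density m D * hyperbola_area (\<nu> * real D / l)"
      by (metis mult.commute times_divide_eq_right)
  qed simp
  finally have main: "(\<lambda>Q. (\<Sum>D=1..M. f D (N Q / (real Q)\<^sup>2 * real D / l) Q) / (N Q / (real Q)\<^sup>2)) \<longlonglongrightarrow>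
      (\<Sum>D=1..M. 2 / real m * delta_density m D * hyperbola_area (\<nu> * real D / l))" .
  have ev1: "eventually (\<lambda>Q. l / (N Q / (real Q)\<^sup>2) < real M) sequentially"
    by (rule order_tendstoD(2)[OF tendsto_divide[OF tendsto_const N]]) (use nu M m in \<open>auto simp: \<nu>_def\<close>)
  have "filterlim (\<lambda>Q. N Q / (real Q)\<^sup>2 * (real Q)\<^sup>2) at_top sequentially"
    by (rule filterlim_tendsto_pos_mult_at_top[OF N nu])
      (intro filterlim_pow_at_top filterlim_real_sequentially, simp)
  then have ev2: "eventually (\<lambda>Q. N Q / (real Q)\<^sup>2 * (real Q)\<^sup>2 > l) sequentially"
    by (simp add: filterlim_at_top_dense)
  have "eventually (\<lambda>Q. (\<Sum>D=1..M. f D (N Q / (real Q)\<^sup>2 * real D / l) Q) / (N Q / (real Q)\<^sup>2) =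
      pair_corr (farey_cong m b Q) {0..l}) sequentially"
    using ev1 ev2 eventually_gt_at_top[of 0]
  proof eventually_elim
    case (elim Q)
    have NQ: "N Q > l" using elim by simp
    have "l * (real Q)\<^sup>2 / N Q \<le> real M" using elim(1) by simp
    note cc = card_close_pairs[OF elim(3) l NQ this, of m b]
    have "(\<Sum>D=1..M. f D (N Q / (real Q)\<^sup>2 * real D / l) Q) =
       (\<Sum>D=1..M. real (card (farey_triples (hyperbola_region (N Q * real D / (l * (real Q)\<^sup>2))) m b b D (real Q) (real Q)))) / (real Q)\<^sup>2"
      unfolding f_def sum_divide_distrib by (simp add: mult.commute)
    also have "\<dots> = real (card {(x, y). x \<in> farey_cong m b Q \<and> y \<in> farey_cong m b Q \<and> y \<noteq> x \<and>
                (\<exists>t\<in>{0..l}. \<exists>k::int. y - x = t / N Q + of_int k)}) / (real Q)\<^sup>2"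
      unfolding cc by simp
    finally show ?case using elim(3) NQ l unfolding pair_corr_def N_def[symmetric] by simp
  qed
  from Lim_transform_eventually[OF main this] show ?thesis unfolding \<nu>_def .
qed

text \<open>Links the counts to \<open>g\<close>: the antiderivative
  \<open>- (ln (x / K) + 1) / x\<close> taken from \<open>K\<close> to \<open>l\<close> is the
  hyperbola area at \<open>K / l\<close>, up to the factor \<open>1 / K\<close>. The cutoff at
  \<open>K\<close> keeps the integrand away from the singularity at 0.\<close>

lemma integral_log_over_square:
  fixes K l :: real
  assumes K: "K > 0" and l: "l > 0"
  shows "has_bochner_integral lborel (\<lambda>x. indicator {0..l} x * (if K \<le> x then ln (x / K) / x\<^sup>2 else 0))
           (hyperbola_area (K / l) / K)"
proof (cases "K \<le> l")
  case True
  define F where "F x = - (ln (x / K) + 1) / x" for x :: real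
  have "has_bochner_integral lborel (\<lambda>x. (ln (x / K) / x\<^sup>2) * indicator {K..l} x) (F l - F K)"
  proof (rule has_bochner_integral_FTC_Icc_real[OF True])
    fix x assume x: "K \<le> x" "x \<le> l"
    then have "x > 0" using K by simp
    then show "DERIV F x :> ln (x / K) / x\<^sup>2"
      unfolding F_def using K
      by (auto intro!: derivative_eq_intros simp: field_simps power2_eq_square)
    show "isCont (\<lambda>x. ln (x / K) / x\<^sup>2) x"
      using \<open>x > 0\<close> K by (intro continuous_intros) auto
  qed
  moreover have "F l - F K = hyperbola_area (K / l) / K"
    using True K l by (simp add: F_def hyperbola_area_def ln_div field_simps)
  moreover have "(\<lambda>x. (ln (x / K) / x\<^sup>2) * indicator {K..l} x) =
      (\<lambda>x. indicator {0..l} x * (if K \<le> x then ln (x / K) / x\<^sup>2 else 0))"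
    using K by (auto simp: fun_eq_iff indicator_def)
  ultimately show ?thesis by simp
next
  case False
  then have "(\<lambda>x. indicator {0..l} x * (if K \<le> x then ln (x / K) / x\<^sup>2 else 0)) = (\<lambda>x. 0)"
    by (auto simp: fun_eq_iff indicator_def)
  moreover have "hyperbola_area (K / l) = 0" using False l by (simp add: hyperbola_area_def)
  ultimately show ?thesis by (simp add: has_bochner_integral_zero)
qed

text \<open>One range of summation serves all \<open>x \<le> l\<close>, so that the sum can be
  integrated term by term; the cutoff moves into the summands. The weights agree by
  \<open>totient_gcd\<close>, which expresses \<open>totient (d * m)\<close> through
  \<open>totient d\<close>, \<open>totient m\<close> and the gcd.\<close>

lemma g_fun_eq:
  assumes m: "m > 0" and x: "0 \<le> x" "x \<le> l" and M: "l / (euler_factor m / (2 * real m)) < real M"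
  shows "g_fun m (real (totient m) * x) =
    (\<Sum>D=1..M. euler_factor m / (real m)\<^sup>2 * delta_density m D * real D *
       (if euler_factor m / (2 * real m) * real D \<le> x
        then ln (x / (euler_factor m / (2 * real m) * real D)) / x\<^sup>2 else 0))"
proof -
  define \<nu> where "\<nu> = euler_factor m / (2 * real m)"
  have E: "euler_factor m > 0" by (rule euler_factor_pos)
  then have nu: "\<nu> > 0" using m by (simp add: \<nu>_def)
  have phi: "real (totient m) > 0" using m by simp
  have C: "C_const m = real (totient m) / real m * euler_factor m"
    by (simp add: C_const_def euler_factor_def)
  have C2: "C_const m = 2 * real (totient m) * \<nu>" using m by (simp add: C \<nu>_def)
  have cond: "2 * (real (totient m) * x) / C_const m = x / \<nu>" using phi by (simp add: C2)
  have cond': "2 * (real (totient m) * x) / (C_const m * real d) = x / (\<nu> * real d)" for d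
    using phi by (simp add: C2)
  have weight: "real (totient d) * (real (gcd d m) / real (totient (gcd d m))) = delta_density m d * real d"
    if "d > 0" for d
  proof -
    have "real (totient (d * m)) * real (totient (gcd d m)) = real (totient d) * real (totient m) * real (gcd d m)"
      by (metis of_nat_mult totient_gcd)
    moreover have "real (totient (gcd d m)) > 0" using m by simp
    ultimately show ?thesis using phi that by (simp add: delta_density_def field_simps)
  qed
  \<comment> \<open>This includes \<open>x = 0\<close>, where both sides are 0 by division by
    0.\<close>
  have factor: "real (totient m) / real m * (C_const m / (real (totient m) * x)\<^sup>2) = euler_factor m / (real m)\<^sup>2 / x\<^sup>2"
    using phi by (simp add: C power2_eq_square)
  have "{d. 1 \<le> d \<and> real d \<le> x / \<nu>} = {D\<in>{1..M}. \<nu> * real D \<le> x}"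
  proof -
    have "d \<le> M" if "real d \<le> x / \<nu>" for d
    proof -
      have "x / \<nu> \<le> l / \<nu>" using x nu by (intro divide_right_mono) auto
      then show ?thesis using that M unfolding \<nu>_def[symmetric] by linarith
    qed
    then show ?thesis using nu by (auto simp: field_simps)
  qed
  then have "g_fun m (real (totient m) * x) = euler_factor m / (real m)\<^sup>2 / x\<^sup>2 *
      (\<Sum>D\<in>{D\<in>{1..M}. \<nu> * real D \<le> x}. real (totient D) * (real (gcd D m) / real (totient (gcd D m))) * ln (x / (\<nu> * real D)))"
    unfolding g_fun_def cond cond' factor by simp
  also have "\<dots> = (\<Sum>D\<in>{D\<in>{1..M}. \<nu> * real D \<le> x}. euler_factor m / (real m)\<^sup>2 * delta_density m D * real D * (ln (x / (\<nu> * real D)) / x\<^sup>2))"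
    unfolding sum_distrib_left
  proof (rule sum.cong)
    fix D assume "D \<in> {D\<in>{1..M}. \<nu> * real D \<le> x}"
    then have "D > 0" by simp
    from weight[OF this]
    show "euler_factor m / (real m)\<^sup>2 / x\<^sup>2 *
        (real (totient D) * (real (gcd D m) / real (totient (gcd D m))) * ln (x / (\<nu> * real D))) =
        euler_factor m / (real m)\<^sup>2 * delta_density m D * real D * (ln (x / (\<nu> * real D)) / x\<^sup>2)"
      by (simp only:) simp
  qed simp
  also have "\<dots> = (\<Sum>D=1..M. if \<nu> * real D \<le> x then euler_factor m / (real m)\<^sup>2 * delta_density m D * real D * (ln (x / (\<nu> * real D)) / x\<^sup>2) else 0)"
    by (rule sum.inter_filter) simp
  also have "\<dots> = (\<Sum>D=1..M. euler_factor m / (real m)\<^sup>2 * delta_density m D * real D * (if \<nu> * real D \<le> x then ln (x / (\<nu> * real D)) / x\<^sup>2 else 0))"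
    by (intro sum.cong) auto
  finally show ?thesis unfolding \<nu>_def .
qed

lemma integral_g_fun:
  assumes m: "m > 0" and l: "l > 0" and M: "l / (euler_factor m / (2 * real m)) < real M"
  shows "has_bochner_integral lborel (\<lambda>x. indicator {0..l} x *\<^sub>R g_fun m (real (totient m) * x))
    (\<Sum>D=1..M. 2 / real m * delta_density m D * hyperbola_area (euler_factor m / (2 * real m) * real D / l))"
proof -
  define \<nu> where "\<nu> = euler_factor m / (2 * real m)"
  have E: "euler_factor m > 0" by (rule euler_factor_pos)
  then have nu: "\<nu> > 0" using m by (simp add: \<nu>_def)
  define w where "w D = euler_factor m / (real m)\<^sup>2 * delta_density m D * real D" for D
  have "has_bochner_integral lborel
      (\<lambda>x. \<Sum>D=1..M. w D * (indicator {0..l} x * (if \<nu> * real D \<le> x then ln (x / (\<nu> * real D)) / x\<^sup>2 else 0)))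
      (\<Sum>D=1..M. w D * (hyperbola_area (\<nu> * real D / l) / (\<nu> * real D)))"
    by (intro has_bochner_integral_sum has_bochner_integral_mult_right integral_log_over_square l)
      (use nu in auto)
  moreover have "(\<lambda>x. \<Sum>D=1..M. w D * (indicator {0..l} x * (if \<nu> * real D \<le> x then ln (x / (\<nu> * real D)) / x\<^sup>2 else 0))) =
      (\<lambda>x. indicator {0..l} x *\<^sub>R g_fun m (real (totient m) * x))"
  proof
    fix x
    show "(\<Sum>D=1..M. w D * (indicator {0..l} x * (if \<nu> * real D \<le> x then ln (x / (\<nu> * real D)) / x\<^sup>2 else 0))) =
      indicator {0..l} x *\<^sub>R g_fun m (real (totient m) * x)"
      using g_fun_eq[OF m _ _ M, of x] unfolding \<nu>_def[symmetric] w_def[symmetric]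
      by (cases "x \<in> {0..l}") auto
  qed
  moreover have "w D * (hyperbola_area (\<nu> * real D / l) / (\<nu> * real D)) =
      2 / real m * delta_density m D * hyperbola_area (\<nu> * real D / l)" if "D \<in> {1..M}" for D
  proof -
    \<comment> \<open>The Euler product cancels, leaving exactly the coefficient in the limit of the
      pair correlations.\<close>
    have "w D / (\<nu> * real D) = 2 / real m * delta_density m D"
      using E m that by (simp add: w_def \<nu>_def power2_eq_square)
    then show ?thesis by (metis mult.commute times_divide_eq_right)
  qed
  ultimately show ?thesis unfolding \<nu>_def[symmetric] by simp
qed

theorem theorem2:
  fixes m :: nat
  assumes "m > 0"
  shows "\<exists>g. (\<forall>b::int. coprime b (int m) \<longrightarrow> has_pair_correlation_function (farey_cong m b) g) \<and>
             (\<forall>l>0. g l = g_fun m (real (totient m) * l))"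
proof (intro exI conjI allI impI)
  fix b :: int assume b: "coprime b (int m)"
  \<comment> \<open>The witness is the formula itself, in which \<open>b\<close> does not
    occur.\<close>
  show "has_pair_correlation_function (farey_cong m b) (\<lambda>l. g_fun m (real (totient m) * l))"
    unfolding has_pair_correlation_function_def
  proof (intro conjI allI impI)
    show "finite (farey_cong m b n)" for n
      unfolding farey_cong_altdef by (intro finite_imageI finite_farey_pairs)
    show "incseq (farey_cong m b)"
      unfolding incseq_def farey_cong_def by force
    fix l :: real assume l: "l > 0"
    \<comment> \<open>The same \<open>M\<close> serves the limit and the integral, so both are
      literally the same finite sum.\<close>
    obtain M :: nat where M: "l / (euler_factor m / (2 * real m)) < real M" using reals_Archimedean2 by blast
    note int = integral_g_fun[OF assms l M]
    show "set_integrable lborel {0..l} (\<lambda>l. g_fun m (real (totient m) * l))"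
      unfolding set_integrable_def by (rule integrable.intros[OF int])
    show "(\<lambda>n. pair_corr (farey_cong m b n) {0..l}) \<longlonglongrightarrow> (LBINT x:{0..l}. g_fun m (real (totient m) * x))"
      unfolding set_lebesgue_integral_def has_bochner_integral_integral_eq[OF int]
      by (rule pair_corr_farey_cong_LIMSEQ[OF assms b l M])
  qed
qed simp

end
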